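(* Let $n$ be a prime with $n\equiv 7\pmod 8$. Let $Q$ and $N$ be the sets of nonzero quadratic residues and nonresidues modulo $n$, $f_Q(X)=\sum_{i\in Q}X^i$, $f_N(X)=\sum_{i\in N}X^i$. Fix a primitive $n$-th root of unity $\xi$ in an algebraic closure of $\mathbb Q_2$, and let $\pi^{(1)}(X)=\prod_{j\in Q}(X-\xi^j)\in\mathbb Z_{2^\infty}[X]$ (a monic irreducible divisor of $X^n-1$ over $\mathbb Z_{2^\infty}$). Let $s=1+2\sum_{j\in Q}\xi^j$; then $s\in\mathbb Z_{2^\infty}$ and $s^2=-n$. In $\mathcal R=\mathbb Z_{2^\infty}[X]/(X^n-1)$, let $C_1=(\pi^{(1)}(X))$ and $C_2=((X-1)\pi^{(1)}(X))$ (the two quadratic residue codes of length $n$ over $\mathbb Z_{2^\infty}$). Then $C_1$ is generated by the idempotent $$e_1=\alpha_1+\beta_1 f_Q(X)+\gamma_1 f_N(X),\quad \alpha_1=\tfrac{n+1}{2n},\ \beta_1=\tfrac{1+s}{2n},\ \gamma_1=\tfrac{1-s}{2n},$$ and $C_2$ is generated by the idempotent $$e_2=\alpha_2+\beta_2 f_Q(X)+\gamma_2 f_N(X),\quad \alpha_2=\tfrac{n-1}{2n},\ \beta_2=\tfrac{-1+s}{2n},\ \gamma_2=\tfrac{-1-s}{2n}$$ (all these coefficients lie in $\mathbb Z_{2^\infty}$). Moreover, let $t\in\mathbb Z_{2^\infty}$ satisfy $t^2=-1/n$, and let $D\subseteq\mathbb Z_{2^\infty}^{n+1}$ be the $\mathbb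 Z_{2^\infty}$-span of the vectors $(c^{(i)},t)$, $i=0,\dots,n-1$, where $c^{(i)}\in\mathbb Z_{2^\infty}^n$ is the coefficient vector of $X^ie_1(X)$ in $\mathcal R$. Then $D$ is a self-dual code of length $n+1$ and type $1^{(n+1)/2}$.
   Context: $\mathbb Z_{2^\infty}$ denotes the ring of 2-adic integers and $\mathbb Q_2$ the field of 2-adic numbers. Elements of $\mathcal R$ are identified with their coefficient vectors $(c_0,\dots,c_{n-1})\in\mathbb Z_{2^\infty}^n$. A code is a $\mathbb Z_{2^\infty}$-submodule $D$ of $\mathbb Z_{2^\infty}^{m}$; its dual is $D^\perp=\{w:\ v\cdot w=\sum v_iw_i=0\ \forall v\in D\}$ and $D$ is self-dual if $D=D^\perp$. $D$ has type $1^k$ if, after a permutation of coordinates, it has a generator matrix of the form $[\,I_k\ \ A\,]$ over $\mathbb Z_{2^\infty}$, i.e. $D$ consists of all $vG$ with $v\in\mathbb Z_{2^\infty}^k$ for such a matrix $G$.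
   Formalization: The parenthetical irreducibility of π^(1) is asserted only when 2 has order (n−1)/2 modulo n, which is exactly when it holds; it fails for n = 31, where 2 has order 5 and π^(1) has degree 15. All other claims are for every prime n ≡ 7 mod 8. *)

theory Defs
  imports
    "HOL-Number_Theory.Number_Theory"
    "HOL-Algebra.Algebraic_Closure_Type"
    "HOL-Algebra.QuotRing"
    "Jordan_Normal_Form.VS_Connect"
begin

text \<open>
  The ring of 2-adic integers as the inverse limit of the rings \<open>\<int>/2\<^sup>k\<close>: the \<open>k\<close>-th component
  is the canonical representative modulo \<open>2\<^sup>k\<close>.
\<close>

typedef z2adic = "{x :: nat \<Rightarrow> int. \<forall>k. x k mod 2 ^ k = x k \<and> x (Suc k) mod 2 ^ k = x k}"
  morphisms z2_res Abs_z2adic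
  by (rule exI[of _ "\<lambda>_. 0"]) auto

setup_lifting type_definition_z2adic

lemma mod_pow2_Suc_mod: "(a mod 2 ^ Suc k) mod 2 ^ k = (a :: int) mod 2 ^ k"
  by (simp add: mod_mod_cancel)

instantiation z2adic :: comm_ring_1
begin

lift_definition zero_z2adic :: z2adic is "\<lambda>_. 0"
  by simp

lift_definition one_z2adic :: z2adic is "\<lambda>k. 1 mod 2 ^ k"
  unfolding mod_pow2_Suc_mod by simp

lift_definition plus_z2adic :: "z2adic \<Rightarrow> z2adic \<Rightarrow> z2adic"
  is "\<lambda>x y k. (x k + y k) mod 2 ^ k"
  unfolding mod_pow2_Suc_mod by (metis mod_add_eq mod_mod_trivial)

lift_definition times_z2adic :: "z2adic \<Rightarrow> z2adic \<Rightarrow> z2adic"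
  is "\<lambda>x y k. (x k * y k) mod 2 ^ k"
  unfolding mod_pow2_Suc_mod by (metis mod_mult_eq mod_mod_trivial)

lift_definition uminus_z2adic :: "z2adic \<Rightarrow> z2adic"
  is "\<lambda>x k. (- x k) mod 2 ^ k"
  unfolding mod_pow2_Suc_mod by (metis mod_minus_eq mod_mod_trivial)

lift_definition minus_z2adic :: "z2adic \<Rightarrow> z2adic \<Rightarrow> z2adic"
  is "\<lambda>x y k. (x k - y k) mod 2 ^ k"
  unfolding mod_pow2_Suc_mod by (metis mod_diff_eq mod_mod_trivial)

instance
proof
  fix a b c :: z2adic
  show "a * b * c = a * (b * c)"
    by transfer (auto simp: fun_eq_iff mod_simps ac_simps)
  show "a * b = b * a"
    by transfer (auto simp: fun_eq_iff ac_simps)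
  show "1 * a = a"
    by transfer (auto simp: fun_eq_iff mod_simps dest: spec[of _ 0])
  show "a + b + c = a + (b + c)"
    by transfer (auto simp: fun_eq_iff mod_simps ac_simps)
  show "a + b = b + a"
    by transfer (auto simp: fun_eq_iff ac_simps)
  show "0 + a = a"
    by transfer (simp add: fun_eq_iff)
  show "- a + a = 0"
    by transfer (auto simp: fun_eq_iff mod_simps)
  show "a - b = a + - b"
    by transfer (auto simp: fun_eq_iff mod_simps)
  show "(a + b) * c = a * c + b * c"
    by transfer (auto simp: fun_eq_iff mod_simps algebra_simps)
  show "(0 :: z2adic) \<noteq> 1"
    by transfer (auto simp: fun_eq_iff intro!: exI[of _ 1])
qed

end

lemma z2_res_mod:
  assumes "j \<le> k"
  shows "z2_res x k mod 2 ^ j = z2_res x j"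
  using assms
proof (induction k rule: dec_induct)
  case base
  show ?case using z2_res[of x] by auto
next
  case (step k)
  have "z2_res x (Suc k) mod 2 ^ j = (z2_res x (Suc k) mod 2 ^ k) mod 2 ^ j"
    using step.hyps by (simp add: mod_mod_cancel le_imp_power_dvd)
  also have "\<dots> = z2_res x k mod 2 ^ j"
    using z2_res[of x] by auto
  finally show ?case using step.IH by simp
qed

instance z2adic :: idom
proof
  fix a b :: z2adic
  assume "a \<noteq> 0" "b \<noteq> 0"
  then obtain i j where i: "z2_res a i \<noteq> 0" and j: "z2_res b j \<noteq> 0"
    by (transfer, auto simp: fun_eq_iff)
  define k where "k = i + j"
  have a: "\<not> 2 ^ i dvd z2_res a k"
    using i z2_res_mod[of i k a] by (auto simp: k_def)
  have b: "\<not> 2 ^ j dvd z2_res b k"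
    using j z2_res_mod[of j k b] by (auto simp: k_def)
  have "\<not> 2 ^ k dvd z2_res a k * z2_res b k"
  proof
    assume dvd: "2 ^ k dvd z2_res a k * z2_res b k"
    have nz: "z2_res a k \<noteq> 0" "z2_res b k \<noteq> 0"
      using a b by auto
    have "prime_elem (2 :: int)" by simp
    then have "k \<le> multiplicity 2 (z2_res a k) + multiplicity 2 (z2_res b k)"
      using dvd nz
      by (simp add: power_dvd_iff_le_multiplicity prime_elem_multiplicity_mult_distrib)
    moreover have "multiplicity 2 (z2_res a k) < i" "multiplicity 2 (z2_res b k) < j"
      using a b nz by (simp_all add: power_dvd_iff_le_multiplicity)
    ultimately show False by (simp add: k_def)
  qed
  then have "z2_res (a * b) k \<noteq> 0"
    by (simp add: times_z2adic.rep_eq dvd_eq_mod_eq_0)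
  then show "a * b \<noteq> 0"
    by (auto simp: zero_z2adic.rep_eq)
qed

type_synonym q2adic = "z2adic fract"

definition z2_to_ac :: "z2adic \<Rightarrow> q2adic alg_closure" where
  "z2_to_ac x = to_ac (to_fract x)"

definition primitive_root_of_unity :: "nat \<Rightarrow> 'a :: field \<Rightarrow> bool" where
  "primitive_root_of_unity n x \<longleftrightarrow> n > 0 \<and> x ^ n = 1 \<and> (\<forall>k. 0 < k \<and> k < n \<longrightarrow> x ^ k \<noteq> 1)"

definition quad_residues :: "nat \<Rightarrow> nat set" where
  "quad_residues n = {i \<in> {1..<n}. QuadRes (int n) (int i)}"

definition quad_nonresidues :: "nat \<Rightarrow> nat set" where
  "quad_nonresidues n = {i \<in> {1..<n}. \<not> QuadRes (int n) (int i)}"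

definition cyc_ideal :: "nat \<Rightarrow> 'a :: comm_ring_1 poly set" where
  "cyc_ideal n = PIdl\<^bsub>class_ring\<^esub> (monom 1 n - 1)"

definition cyc_ring :: "nat \<Rightarrow> 'a :: comm_ring_1 poly set ring" where
  "cyc_ring n = class_ring Quot (cyc_ideal n)"

definition cyc_class :: "nat \<Rightarrow> 'a :: comm_ring_1 poly \<Rightarrow> 'a poly set" where
  "cyc_class n f = cyc_ideal n +>\<^bsub>class_ring\<^esub> f"

text \<open>
  The coefficient vector of a residue class modulo \<open>X\<^sup>n - 1\<close> (for \<open>n > 0\<close>) is that of its unique
  representative of degree less than \<open>n\<close>.
\<close>

definition cyc_coeffs :: "nat \<Rightarrow> 'a :: comm_ring_1 poly set \<Rightarrow> 'a vec" where
  "cyc_coeffs n c = (THE v. v \<in> carrier_vec n \<and> Poly (list_of_vec v) \<in> c)"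

lemma cyc_class_iff: "g \<in> cyc_class n f \<longleftrightarrow> monom 1 n - 1 dvd g - (f :: 'a :: comm_ring_1 poly)"
proof
  assume "g \<in> cyc_class n f"
  then show "monom 1 n - 1 dvd g - f"
    by (auto simp: cyc_class_def cyc_ideal_def cgenideal_def a_r_coset_def r_coset_def)
next
  assume "monom 1 n - 1 dvd g - f"
  then obtain h where "g - f = (monom 1 n - 1) * h" ..
  then have "g = h * (monom 1 n - 1) + f"
    by (simp add: algebra_simps)
  then show "g \<in> cyc_class n f"
    by (auto simp: cyc_class_def cyc_ideal_def cgenideal_def a_r_coset_def r_coset_def)
qed

lemma cyc_coeffs_unique:
  fixes f :: "'a :: comm_ring_1 poly"
  assumes "n > 0"
  shows "\<exists>!v. v \<in> carrier_vec n \<and> Poly (list_of_vec v) \<in> cyc_class n f"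
proof -
  define m where "m = (monom 1 n - 1 :: 'a poly)"
  have cm: "coeff m n = 1" using assms by (simp add: m_def)
  have dm: "degree m = n"
  proof (rule antisym)
    show "degree m \<le> n"
      unfolding m_def by (rule degree_diff_le) (auto simp: degree_monom_le)
    show "n \<le> degree m" using cm by (intro le_degree) auto
  qed
  have m0: "m \<noteq> 0" using cm by auto
  obtain q r where qr: "pseudo_divmod f m = (q, r)" by force
  have f: "f = m * q + r" and r: "r = 0 \<or> degree r < n"
    using pseudo_divmod[OF m0 qr] cm dm by auto
  have rc: "coeff r i = 0" if "i \<ge> n" for i
    using r that by (auto intro: coeff_eq_0)
  have cP: "coeff (Poly (list_of_vec v)) i = (if i < n then v $ i else 0)"
    if "v \<in> carrier_vec n" for v :: "'a vec" and i
    using that by (auto simp: nth_default_def list_of_vec_index)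
  show ?thesis
  proof (rule ex1I[of _ "vec n (coeff r)"], intro conjI)
    have "Poly (list_of_vec (vec n (coeff r))) = r"
      by (rule poly_eqI) (subst cP, auto simp: rc)
    then show "Poly (list_of_vec (vec n (coeff r))) \<in> cyc_class n f"
      unfolding cyc_class_iff m_def[symmetric] by (simp add: f)
  next
    fix v assume v: "v \<in> carrier_vec n \<and> Poly (list_of_vec v) \<in> cyc_class n f"
    define p where "p = Poly (list_of_vec v)"
    have "m dvd p - f" using v by (simp add: cyc_class_iff m_def p_def)
    then have "m dvd (p - f) + m * q" by (intro dvd_add) auto
    then obtain h where h: "p - r = m * h" by (auto simp: f)
    have "h = 0"
    proof (rule ccontr)
      assume "h \<noteq> 0"
      then have "coeff (m * h) (n + degree h) \<noteq> 0"
        using coeff_mult_degree_sum[of m h] cm dm by simp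
      moreover have "coeff (p - r) (n + degree h) = 0"
        using v by (simp add: p_def cP rc del: coeff_Poly_eq)
      ultimately show False using h by simp
    qed
    then have "p = r" using h by simp
    then show "v = vec n (coeff r)"
      using v cP[of v] by (intro eq_vecI) (auto simp: p_def simp del: coeff_Poly_eq)
  qed simp
qed

definition generated_by_idempotent :: "('a, 'b) ring_scheme \<Rightarrow> 'a set \<Rightarrow> 'a \<Rightarrow> bool" where
  "generated_by_idempotent R I e \<longleftrightarrow>
     e \<in> carrier R \<and> e \<otimes>\<^bsub>R\<^esub> e = e \<and> I = PIdl\<^bsub>R\<^esub> e"

definition linear_code :: "nat \<Rightarrow> 'a :: comm_ring_1 vec set \<Rightarrow> bool" where
  "linear_code m D \<longleftrightarrow> LinearCombinations.submodule class_ring D (module_vec TYPE('a) m)"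

definition code_span :: "nat \<Rightarrow> 'a :: comm_ring_1 vec set \<Rightarrow> 'a vec set" where
  "code_span m S = LinearCombinations.module.span class_ring (module_vec TYPE('a) m) S"

definition dual_code :: "nat \<Rightarrow> 'a :: comm_ring_1 vec set \<Rightarrow> 'a vec set" where
  "dual_code m D = {w \<in> carrier_vec m. \<forall>v\<in>D. v \<bullet> w = 0}"

definition self_dual_code :: "nat \<Rightarrow> 'a :: comm_ring_1 vec set \<Rightarrow> bool" where
  "self_dual_code m D \<longleftrightarrow> linear_code m D \<and> D = dual_code m D"

definition standard_gen_mat :: "nat \<Rightarrow> nat \<Rightarrow> 'a :: comm_ring_1 mat \<Rightarrow> 'a mat" where
  "standard_gen_mat m k A = four_block_mat (1\<^sub>m k) A (0\<^sub>m 0 k) (0\<^sub>m 0 (m - k))"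

text \<open>
  Type \<open>1\<^sup>k\<close>, for a code of length \<open>m\<close>. The lower blocks of \<^const>\<open>standard_gen_mat\<close> have no rows,
  so it is the \<open>k\<close> by \<open>m\<close> matrix \<open>[I A]\<close>; the row vector \<open>vG\<close> is written as \<open>G\<^sup>T v\<close>.
\<close>

definition has_type_one :: "nat \<Rightarrow> nat \<Rightarrow> 'a :: comm_ring_1 vec set \<Rightarrow> bool" where
  "has_type_one m k D \<longleftrightarrow> k \<le> m \<and>
     (\<exists>p A. p permutes {..<m} \<and> A \<in> carrier_mat k (m - k) \<and>
        (\<lambda>v. vec m (\<lambda>i. v $ p i)) ` D =
        (\<lambda>v. transpose_mat (standard_gen_mat m k A) *\<^sub>v v) ` carrier_vec k)"

end

theory Submission
  imports Defs "Jordan_Normal_Form.Char_Poly"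
begin

text \<open>
  Everything is checked by evaluation at the powers of \<open>\<xi>\<close>, since a 2-adic polynomial is divisible by
  \<open>X\<^sup>n - 1\<close> iff it vanishes at all of them. The Gauss sum \<open>s\<close> satisfies \<open>s\<^sup>2 = - n\<close>, and \<open>- n\<close> is
  a 2-adic square. An element of \<open>\<int>\<^sub>2[\<xi>]\<close> fixed by \<open>\<xi> \<mapsto> \<xi>\<^sup>r\<close> for all residues \<open>r\<close> is therefore 2-adic
  (average over the residues, whose number is odd), which applies to the coefficients of \<open>\<pi>\<close>.
  For a factor \<open>f\<close> of \<open>X\<^sup>n - 1 = f g\<close>, the congruence \<open>g(X\<^sup>2) \<equiv> g(X)\<^sup>2\<close> modulo 2 shows that the roots of
  \<open>f\<close> are closed under squaring; hence \<open>\<pi>\<close> is irreducible when 2 generates the residues.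
  The idempotent \<open>e\<^sub>1\<close> vanishes at \<open>\<xi>\<^sup>j\<close> for residues \<open>j\<close> and is 1 at the other powers, so that \<open>D\<close>
  consists of all \<open>(u, t u(1))\<close> with \<open>u\<close> vanishing at these \<open>\<xi>\<^sup>j\<close>. As \<open>- 1\<close> is a nonresidue, Parseval's
  identity makes \<open>D\<close> self-dual, and division by the monic \<open>\<pi>\<close> makes it systematic in the coordinates
  \<open>(n - 1)/2, \<dots>, n - 1\<close>.
\<close>

subsection \<open>2-adic integers\<close>

lemma z2_res_less: "z2_res x k mod 2 ^ k = z2_res x k"
  using z2_res_mod[of k k x] by simp

lemma z2adic_eqI: "(\<And>k. z2_res x k = z2_res y k) \<Longrightarrow> x = y"
  by (simp add: z2_res_inject[symmetric] fun_eq_iff)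

lemma z2_res_of_nat: "z2_res (of_nat m) k = int m mod 2 ^ k"
  by (induction m) (simp_all add: zero_z2adic.rep_eq one_z2adic.rep_eq plus_z2adic.rep_eq mod_simps)

lemma z2_res_of_int: "z2_res (of_int m) k = m mod 2 ^ k"
  by (cases m rule: int_cases2)
    (simp_all add: z2_res_of_nat uminus_z2adic.rep_eq mod_simps)

text \<open>Characteristic zero passes to the fraction field and its algebraic closure, where
  \<open>n\<close>, \<open>n - 1\<close> and 2 get cancelled.\<close>

instance z2adic :: ring_char_0
proof
  show "inj (of_nat :: nat \<Rightarrow> z2adic)"
  proof (rule injI)
    fix a b :: nat
    assume "(of_nat a :: z2adic) = of_nat b"
    then have "int a mod 2 ^ (a + b) = int b mod 2 ^ (a + b)"
      by (metis z2_res_of_nat)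
    moreover have "a < 2 ^ (a + b)" "b < 2 ^ (a + b)"
      by (metis add_lessD1 add.commute less_exp)+
    then have "int a < 2 ^ (a + b)" "int b < 2 ^ (a + b)"
      by (metis of_nat_less_iff of_nat_numeral of_nat_power)+
    ultimately show "a = b"
      by simp
  qed
qed

lemma of_nat_fract_conv: "(of_nat m :: 'a :: idom fract) = to_fract (of_nat m)"
  by (induction m) simp_all

instance fract :: ("{idom, ring_char_0}") field_char_0
  by standard (auto simp: inj_on_def of_nat_fract_conv)

lemma z2adic_coherent:
  assumes "\<And>k. [f (Suc k) = f k] (mod 2 ^ k)"
  obtains x where "\<And>k. z2_res x k = f k mod 2 ^ k"
proof
  define x where "x = Abs_z2adic (\<lambda>k. f k mod 2 ^ k)"
  have "z2_res x = (\<lambda>k. f k mod 2 ^ k)"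
    unfolding x_def using assms
    by (intro Abs_z2adic_inverse) (auto simp: mod_mod_cancel cong_def)
  then show "z2_res x k = f k mod 2 ^ k" for k
    by simp
qed

text \<open>The right-hand side is a contraction for the 2-adic metric.\<close>

lemma z2adic_quadratic_fixpoint:
  "\<exists>z :: z2adic. z = of_int a + 2 * (of_int b * z + of_int c * z ^ 2)"
proof -
  define F where "F = (\<lambda>z. a + 2 * (b * z + c * z ^ 2))"
  have contr: "[F x = F y] (mod 2 ^ Suc k)" if "[x = y] (mod 2 ^ k)" for x y k
  proof -
    have "[b * x + c * x ^ 2 = b * y + c * y ^ 2] (mod 2 ^ k)"
      using that by (intro cong_add cong_mult cong_pow cong_refl)
    then have "[2 * (b * x + c * x ^ 2) = 2 * (b * y + c * y ^ 2)] (mod 2 ^ Suc k)"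
      unfolding cong_iff_dvd_diff right_diff_distrib[symmetric] power_Suc by (rule mult_dvd_mono[OF dvd_refl])
    then show ?thesis
      unfolding F_def by (intro cong_add cong_refl)
  qed
  \<comment> \<open>The iterates from 0 converge: each application fixes one more binary digit, so
    the k-th iterate is correct modulo \<open>2 ^ k\<close>.\<close>
  define f where "f = (\<lambda>k. (F ^^ k) 0)"
  have step: "[f (Suc k) = f k] (mod 2 ^ k)" for k
    by (induction k) (use contr in \<open>auto simp: f_def\<close>)
  obtain z where z: "\<And>k. z2_res z k = f k mod 2 ^ k"
    using z2adic_coherent[OF step] by blast
  have "z2_res (of_int a + 2 * (of_int b * z + of_int c * z ^ 2)) k = z2_res z k" for k
  proof -
    \<comment> \<open>The numeral is written \<open>of_int 2\<close> so that its components are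
      given by \<open>z2_res_of_int\<close>.\<close>
    have "z2_res (of_int a + of_int 2 * (of_int b * z + of_int c * z ^ 2)) k = F (f k) mod 2 ^ k"
      by (simp only: power2_eq_square F_def plus_z2adic.rep_eq times_z2adic.rep_eq z2_res_of_int z mod_simps)
    also have "F (f k) = f (Suc k)"
      by (simp add: f_def)
    also have "\<dots> mod 2 ^ k = z2_res z k"
      using step[of k] by (simp add: z cong_def)
    finally show ?thesis by simp
  qed
  then show ?thesis
    by (metis z2adic_eqI)
qed

lemma odd_dvd_one_z2adic:
  assumes "odd m"
  shows "\<exists>u :: z2adic. of_nat m * u = 1"
proof -
  obtain k where m: "m = 2 * k + 1"
    using assms by (rule oddE)
  \<comment> \<open>For \<open>m = 2 * k + 1\<close> the equation \<open>m * u = 1\<close> reads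
    \<open>u = 1 - 2 * k * u\<close>, a fixpoint equation of the required shape.\<close>
  obtain u :: z2adic where "u = of_int 1 + 2 * (of_int (- int k) * u + of_int 0 * u ^ 2)"
    using z2adic_quadratic_fixpoint by blast
  then have "of_nat m * u = 1"
    by (simp add: m algebra_simps)
  then show ?thesis ..
qed

section \<open>Squaring modulo 2\<close>

lemma two_not_dvd_one_z2adic: "2 * (x :: z2adic) \<noteq> 1"
proof
  assume "2 * x = 1"
  then have "z2_res (of_int 2 * x) 1 = z2_res 1 1"
    by simp
  then show False
    by (simp add: times_z2adic.rep_eq z2_res_of_int one_z2adic.rep_eq del: of_int_numeral)
qed

text \<open>Squaring is the identity on the residue field with two elements. Halving costs one
  binary digit, so the k-th component of the quotient is read off from component
  \<open>k + 1\<close> of the difference.\<close>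

lemma square_cong_z2adic: "\<exists>y. x ^ 2 = x + 2 * (y :: z2adic)"
proof -
  define d where "d = x ^ 2 - x"
  have even: "even (z2_res d k)" for k
  proof (cases k)
    case (Suc j)
    have "z2_res d k = (z2_res x k ^ 2 - z2_res x k) mod (2 * 2 ^ j)"
      by (simp add: d_def power2_eq_square minus_z2adic.rep_eq times_z2adic.rep_eq mod_simps Suc)
    moreover have "even (z2_res x k ^ 2 - z2_res x k)"
      by simp
    ultimately show ?thesis
      by (metis dvd_mod dvd_triv_left)
  qed (use z2_res_less[of d 0] in simp)
  have "[z2_res d (Suc (Suc k)) div 2 = z2_res d (Suc k) div 2] (mod 2 ^ k)" for k
  proof -
    have "[z2_res d (Suc (Suc k)) = z2_res d (Suc k)] (mod 2 * 2 ^ k)"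
      using z2_res_mod[of "Suc k" "Suc (Suc k)" d] z2_res_less[of d "Suc k"] by (simp add: cong_def)
    then have "2 * 2 ^ k dvd 2 * (z2_res d (Suc (Suc k)) div 2) - 2 * (z2_res d (Suc k) div 2)"
      using even by (simp add: cong_iff_dvd_diff)
    then have "2 * 2 ^ k dvd 2 * (z2_res d (Suc (Suc k)) div 2 - z2_res d (Suc k) div 2)"
      by (simp only: right_diff_distrib)
    then show ?thesis
      by (simp only: cong_iff_dvd_diff dvd_mult_cancel_left) simp
  qed
  then obtain y where y: "\<And>k. z2_res y k = z2_res d (Suc k) div 2 mod 2 ^ k"
    using z2adic_coherent[of "\<lambda>k. z2_res d (Suc k) div 2"] by auto
  have "z2_res (of_int 2 * y) k = z2_res d k" for k
  proof -
    have "z2_res (of_int 2 * y) k = (2 * (z2_res d (Suc k) div 2)) mod 2 ^ k"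
      by (simp only: times_z2adic.rep_eq z2_res_of_int y mod_simps)
    also have "\<dots> = z2_res d k"
      using even z2_res_mod[of k "Suc k" d] by simp
    finally show ?thesis .
  qed
  then have "of_int 2 * y = d"
    by (rule z2adic_eqI)
  then have "x ^ 2 = x + 2 * y"
    by (simp add: d_def algebra_simps)
  then show ?thesis ..
qed

text \<open>Frobenius over the field with two elements: modulo 2 squaring is additive and, by
  \<open>square_cong_z2adic\<close>, fixes the coefficients, so it only replaces X by its
  square.\<close>

lemma pcompose_square_cong_z2adic:
  "\<exists>h. pcompose g (monom 1 2) = g ^ 2 + 2 * (h :: z2adic poly)"
proof (induction g)
  case 0
  then show ?case by (auto intro: exI[of _ 0])
next
  case (pCons a g)
  then obtain h where h: "pcompose g (monom 1 2) = g ^ 2 + 2 * h" by blast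
  obtain b where b: "a ^ 2 = a + 2 * b"
    using square_cong_z2adic by blast
  define Y :: "z2adic poly" where "Y = [:0, 1:]"
  have Y2: "monom 1 2 = Y ^ 2"
    by (simp only: Y_def x_as_monom x_pow_n)
  have "[:a:] ^ 2 = [:a:] + 2 * [:b:]"
    using b by (simp add: power2_eq_square numeral_poly)
  then have a: "[:a:] = [:a:] ^ 2 - 2 * [:b:]"
    by simp
  have expand: "(c ^ 2 - 2 * d) + y ^ 2 * (u ^ 2 + 2 * v)
      = (c + y * u) ^ 2 + 2 * (y ^ 2 * v - d - c * y * u)" for c d y u v :: "z2adic poly"
    by (simp add: power2_eq_square algebra_simps)
  have "pcompose (pCons a g) (monom 1 2) = ([:a:] ^ 2 - 2 * [:b:]) + Y ^ 2 * (g ^ 2 + 2 * h)"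
    unfolding pcompose_pCons h a[symmetric] unfolding Y2 ..
  also have "\<dots> = ([:a:] + Y * g) ^ 2 + 2 * (Y ^ 2 * h - [:b:] - [:a:] * Y * g)"
    by (rule expand)
  also have "[:a:] + Y * g = pCons a g"
    by (simp add: Y_def)
  finally show ?case ..
qed

interpretation z2_to_ac: inj_idom_hom z2_to_ac
  by unfold_locales (simp_all add: z2_to_ac_def)

lemmas z2_to_ac_simps = z2_to_ac.hom_add z2_to_ac.hom_mult z2_to_ac.hom_minus z2_to_ac.hom_uminus
  z2_to_ac.hom_power z2_to_ac.hom_sum z2_to_ac.hom_of_nat z2_to_ac.hom_numeral

interpretation z2_to_ac_poly: map_poly_inj_idom_hom z2_to_ac ..

subsection \<open>Quadratic residues and roots of unity\<close>

text \<open>Turns Euler's congruences into equalities of Legendre symbols: the difference is at most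
  2 in absolute value.\<close>

lemma small_cong_imp_eq:
  assumes "[x = y] (mod int p)" "\<bar>x\<bar> \<le> 1" "\<bar>y\<bar> \<le> 1" "2 < p"
  shows "x = y"
proof -
  have "int p dvd x - y" "\<bar>x - y\<bar> < int p"
    using assms by (auto simp: cong_iff_dvd_diff)
  then show ?thesis
    using dvd_imp_le_int[of "x - y" "int p"] by fastforce
qed

lemma abs_Legendre_le_one: "\<bar>Legendre a p\<bar> \<le> 1"
  by (simp add: Legendre_def)

lemma Legendre_mult:
  assumes "Factorial_Ring.prime p" "2 < p"
  shows "Legendre (a * b) (int p) = Legendre a (int p) * Legendre b (int p)"
proof -
  have "[Legendre a p * Legendre b p = (a * b) ^ ((p - 1) div 2)] (mod p)"
    using cong_mult[OF euler_criterion[OF assms, of a] euler_criterion[OF assms, of b]]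
    by (simp add: power_mult_distrib)
  then have "[Legendre (a * b) p = Legendre a p * Legendre b p] (mod p)"
    using euler_criterion[OF assms, of "a * b"] by (metis cong_sym cong_trans)
  then show ?thesis
    using assms(2) by (intro small_cong_imp_eq[of _ _ p]) (auto simp: Legendre_def)
qed

lemma Legendre_cong: "[a = b] (mod p) \<Longrightarrow> Legendre a p = Legendre b p"
  by (simp add: Legendre_def QuadRes_def cong_def)

text \<open>The root is a parameter, so that the results can later be reused with a power of
  \<open>\<xi>\<close> in its place.\<close>

locale qr_root_of_unity =
  fixes n :: nat and \<xi> :: "q2adic alg_closure"
  assumes prime_n: "Factorial_Ring.prime n" and n_mod: "n mod 8 = 7"
    and primitive: "primitive_root_of_unity n \<xi>"
begin

abbreviation Q :: "nat set" where "Q \<equiv> quad_residues n"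
abbreviation N :: "nat set" where "N \<equiv> quad_nonresidues n"
abbreviation \<chi> :: "nat \<Rightarrow> int" where "\<chi> a \<equiv> Legendre (int a) (int n)"

lemma n_gt_2: "2 < n"
  using n_mod by (cases "n < 8") auto

lemma n_pos: "0 < n"
  using n_gt_2 by simp

lemma \<chi>_mod: "\<chi> (a mod n) = \<chi> a"
  by (rule Legendre_cong) (simp add: cong_def zmod_int)

lemma \<chi>_mult: "\<chi> (a * b) = \<chi> a * \<chi> b"
  using Legendre_mult[OF prime_n n_gt_2] by simp

lemma \<chi>_eq_0_iff: "\<chi> a = 0 \<longleftrightarrow> n dvd a"
  by (auto simp: Legendre_def cong_0_iff)

lemma mem_Q_iff: "a \<in> Q \<longleftrightarrow> a < n \<and> \<chi> a = 1"
  using \<chi>_eq_0_iff[of a] by (auto simp: quad_residues_def Legendre_def intro: Suc_leI gr0I)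

lemma mem_N_iff: "a \<in> N \<longleftrightarrow> a < n \<and> \<chi> a = - 1"
  using \<chi>_eq_0_iff[of a] by (auto simp: quad_nonresidues_def Legendre_def intro: Suc_leI gr0I)

lemma finite_Q: "finite Q" and finite_N: "finite N"
  by (simp_all add: quad_residues_def quad_nonresidues_def)

lemma lessThan_n_eq: "{..<n} = insert 0 (Q \<union> N)"
  and Q_N_disjoint: "Q \<inter> N = {}" and zero_notin: "0 \<notin> Q" "0 \<notin> N"
  using n_pos by (auto simp: quad_residues_def quad_nonresidues_def Suc_le_eq)

lemma sum_lessThan_n:
  fixes f :: "nat \<Rightarrow> 'a :: comm_monoid_add"
  shows "(\<Sum>j<n. f j) = f 0 + (\<Sum>j\<in>Q. f j) + (\<Sum>j\<in>N. f j)"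
  using finite_Q finite_N Q_N_disjoint zero_notin
  by (simp add: lessThan_n_eq sum.union_disjoint add.assoc)

text \<open>Euler's criterion, as \<open>(n - 1) div 2\<close> is odd. The natural number
  \<open>n - 1\<close> stands for -1 in indices and exponents throughout.\<close>

lemma \<chi>_minus_one: "\<chi> (n - 1) = - 1"
proof -
  have "odd ((n - 1) div 2)"
    using n_mod by presburger
  then have "[Legendre (- 1) (int n) = - 1] (mod int n)"
    using euler_criterion[OF prime_n n_gt_2, of "- 1"] by simp
  then have "Legendre (- 1) (int n) = - 1"
    by (rule small_cong_imp_eq) (use n_gt_2 abs_Legendre_le_one in auto)
  moreover have "[int (n - 1) = - 1] (mod int n)"
    using n_pos by (simp add: cong_iff_dvd_diff)
  ultimately show ?thesis
    using Legendre_cong by metis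
qed

lemma bij_betw_mult_mod:
  assumes "\<chi> r \<noteq> 0"
  shows "bij_betw (\<lambda>j. r * j mod n) {..<n} {..<n}"
proof -
  have "coprime r n"
    using assms prime_n by (metis \<chi>_eq_0_iff coprime_commute prime_imp_coprime)
  then have "inj_on (\<lambda>j. r * j mod n) {..<n}"
    by (auto simp: inj_on_def cong_def[symmetric] cong_mult_lcancel_nat cong_less_modulus_unique_nat)
  moreover have "(\<lambda>j. r * j mod n) ` {..<n} \<subseteq> {..<n}"
    using n_pos by auto
  ultimately show ?thesis
    by (auto simp: bij_betw_def endo_inj_surj)
qed

lemma bij_betw_restrict_iff:
  assumes "bij_betw f A B" "\<And>x. x \<in> A \<Longrightarrow> P x \<longleftrightarrow> R (f x)"
  shows "bij_betw f {x \<in> A. P x} {y \<in> B. R y}"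
  using assms by (auto simp: bij_betw_def inj_on_def)

lemma Q_def': "Q = {a \<in> {..<n}. \<chi> a = 1}" and N_def': "N = {a \<in> {..<n}. \<chi> a = - 1}"
  by (auto simp: mem_Q_iff mem_N_iff)

lemma bij_betw_Q_Q: "r \<in> Q \<Longrightarrow> bij_betw (\<lambda>j. r * j mod n) Q Q"
  unfolding Q_def' by (rule bij_betw_restrict_iff[OF bij_betw_mult_mod]) (auto simp: \<chi>_mod \<chi>_mult simp del: of_nat_mult)

lemma bij_betw_Q_N: "r \<in> N \<Longrightarrow> bij_betw (\<lambda>j. r * j mod n) Q N"
  unfolding Q_def' N_def'
  by (rule bij_betw_restrict_iff[OF bij_betw_mult_mod]) (auto simp: \<chi>_mod \<chi>_mult simp del: of_nat_mult)

lemma card_N: "card N = card Q"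
  using bij_betw_same_card[OF bij_betw_Q_N[of "n - 1"]] n_pos \<chi>_minus_one
  by (simp add: mem_N_iff)

lemma card_Q: "2 * card Q + 1 = n"
proof -
  have "card {..<n} = Suc (card Q + card N)"
    unfolding lessThan_n_eq using finite_Q finite_N Q_N_disjoint zero_notin
    by (simp add: card_Un_disjoint)
  then show ?thesis by (simp add: card_N)
qed

lemma odd_n: "odd n"
  using card_Q by presburger

lemma odd_card_Q: "odd (card Q)"
  using card_Q n_mod by presburger

lemma one_in_Q: "1 \<in> Q"
  using n_gt_2 by (auto simp: quad_residues_def QuadRes_def intro!: exI[of _ 1])

section \<open>Powers of the root of unity and their orthogonality\<close>

lemma root_pow_n: "\<xi> ^ n = 1"
  using primitive by (simp add: primitive_root_of_unity_def)

lemma root_nonzero: "\<xi> \<noteq> 0"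
  using root_pow_n n_pos by (auto simp: power_0_left)

lemma root_pow_mod: "\<xi> ^ (a mod n) = \<xi> ^ a"
proof -
  have "\<xi> ^ a = \<xi> ^ (n * (a div n) + a mod n)"
    by simp
  also have "\<dots> = \<xi> ^ (a mod n)"
    unfolding power_add power_mult root_pow_n by simp
  finally show ?thesis by simp
qed

lemma root_pow_eq_1_iff: "\<xi> ^ a = 1 \<longleftrightarrow> n dvd a"
proof -
  have "\<xi> ^ (a mod n) = 1 \<longleftrightarrow> a mod n = 0"
    using primitive n_pos by (auto simp: primitive_root_of_unity_def)
  then show ?thesis
    by (simp add: root_pow_mod dvd_eq_mod_eq_0)
qed

lemma root_pow_eq_iff: "\<xi> ^ a = \<xi> ^ b \<longleftrightarrow> [a = b] (mod n)"
proof (induction a b rule: linorder_wlog)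
  case (le a b)
  have "\<xi> ^ b = \<xi> ^ a * \<xi> ^ (b - a)"
    using le by (simp flip: power_add)
  then have "\<xi> ^ a = \<xi> ^ b \<longleftrightarrow> \<xi> ^ (b - a) = 1"
    using root_nonzero by auto
  also have "\<dots> \<longleftrightarrow> [b = a] (mod n)"
    using le by (simp add: root_pow_eq_1_iff cong_altdef_nat)
  finally show ?case by (simp add: cong_sym_eq)
qed (auto simp: cong_sym_eq)

lemma inj_on_root_pow: "inj_on (\<lambda>j. \<xi> ^ j) {..<n}"
  by (auto simp: inj_on_def root_pow_eq_iff cong_less_modulus_unique_nat)

lemma inverse_root_pow: "inverse (\<xi> ^ j) = \<xi> ^ ((n - 1) * j)"
proof -
  have "\<xi> ^ j * \<xi> ^ ((n - 1) * j) = \<xi> ^ (n * j)"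
    using n_pos by (cases n) (simp_all flip: power_add)
  then have "\<xi> ^ j * \<xi> ^ ((n - 1) * j) = 1"
    by (simp add: power_mult root_pow_n)
  then show ?thesis
    by (rule inverse_unique)
qed

lemma sum_root_pow: "(\<Sum>j<n. (\<xi> ^ a) ^ j) = (if n dvd a then of_nat n else 0)"
proof (cases "n dvd a")
  case True
  then have "\<xi> ^ a = 1"
    by (simp add: root_pow_eq_1_iff)
  then show ?thesis
    using True by simp
next
  case False
  have "(\<xi> ^ a) ^ n = 1"
    by (metis power_mult mult.commute root_pow_n power_one)
  then have "(1 - \<xi> ^ a) * (\<Sum>j<n. (\<xi> ^ a) ^ j) = 0"
    by (metis one_diff_power_eq diff_self)
  then show ?thesis
    using False by (simp add: root_pow_eq_1_iff eq_commute[of 1])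
qed

lemma character_orthogonality:
  assumes "a < n" "b < n"
  shows "(\<Sum>j<n. (\<xi> ^ j) ^ a * inverse (\<xi> ^ j) ^ b) = (if a = b then of_nat n else 0)"
proof -
  have "(\<xi> ^ j) ^ a * inverse (\<xi> ^ j) ^ b = (\<xi> ^ (a + (n - 1) * b)) ^ j" for j
    by (simp add: inverse_root_pow power_add power_mult_distrib flip: power_mult)
      (simp add: ac_simps)
  moreover have "n dvd a + (n - 1) * b \<longleftrightarrow> a = b"
  proof -
    \<comment> \<open>Adding \<open>b\<close> turns the exponent into \<open>a + n * b\<close>,
      whose residue modulo \<open>n\<close> is \<open>a\<close>.\<close>
    have "n dvd a + (n - 1) * b \<longleftrightarrow> [b + (a + (n - 1) * b) = b] (mod n)"
      by (simp add: cong_0_iff[symmetric] cong_add_lcancel_0_nat)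
    also have "b + (a + (n - 1) * b) = a + n * b"
      using n_pos by (cases n) simp_all
    also have "[a + n * b = b] (mod n) \<longleftrightarrow> a = b"
      using assms by (auto simp: cong_def)
    finally show ?thesis .
  qed
  ultimately show ?thesis
    by (simp add: sum_root_pow)
qed

text \<open>Expand and apply orthogonality of characters. Inverse roots take the place of complex
  conjugates, so the form is bilinear.\<close>

lemma parseval:
  "(\<Sum>j<n. (\<Sum>a<n. u a * (\<xi> ^ j) ^ a) * (\<Sum>b<n. v b * inverse (\<xi> ^ j) ^ b))
    = of_nat n * (\<Sum>a<n. u a * v a)"
proof -
  have "(\<Sum>j<n. (\<Sum>a<n. u a * (\<xi> ^ j) ^ a) * (\<Sum>b<n. v b * inverse (\<xi> ^ j) ^ b))
      = (\<Sum>j<n. \<Sum>a<n. \<Sum>b<n. u a * v b * ((\<xi> ^ j) ^ a * inverse (\<xi> ^ j) ^ b))"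
    by (simp add: sum_product ac_simps)
  also have "\<dots> = (\<Sum>a<n. \<Sum>b<n. \<Sum>j<n. u a * v b * ((\<xi> ^ j) ^ a * inverse (\<xi> ^ j) ^ b))"
    by (subst sum.swap) (auto intro!: sum.cong sum.swap)
  also have "\<dots> = (\<Sum>a<n. \<Sum>b<n. u a * v b * (if a = b then of_nat n else 0))"
    by (simp add: character_orthogonality flip: sum_distrib_left)
  also have "\<dots> = (\<Sum>a<n. u a * v a * of_nat n)"
    by (intro sum.cong refl) (simp add: if_distrib[of "(*) _"] cong: if_cong)
  finally show ?thesis
    by (simp add: sum_distrib_left ac_simps)
qed

subsection \<open>Quadratic Gauss sum\<close>

definition gauss_sum :: "q2adic alg_closure" where
  "gauss_sum = (\<Sum>a<n. of_int (\<chi> a) * \<xi> ^ a)"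

text \<open>Substitute \<open>j * a\<close> for \<open>a\<close>: as \<open>\<chi> j\<close> squares
  to 1, \<open>\<chi> a\<close> is \<open>\<chi> j * \<chi> (j * a)\<close>. For \<open>n\<close>
  dividing \<open>j\<close> both sides vanish, there being as many residues as nonresidues.\<close>

lemma gauss_sum_twist: "(\<Sum>a<n. of_int (\<chi> a) * (\<xi> ^ j) ^ a) = of_int (\<chi> j) * gauss_sum"
proof (cases "\<chi> j = 0")
  case True
  then have "\<xi> ^ j = 1"
    by (simp add: \<chi>_eq_0_iff root_pow_eq_1_iff)
  then show ?thesis
    using True \<chi>_eq_0_iff[of 0] by (simp add: sum_lessThan_n mem_Q_iff mem_N_iff card_N)
next
  case False
  then have sq: "\<chi> j * \<chi> j = 1"
    by (auto simp: Legendre_def)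
  have "(\<Sum>a<n. of_int (\<chi> a) * (\<xi> ^ j) ^ a)
      = (\<Sum>a<n. of_int (\<chi> j * \<chi> (j * a mod n)) * \<xi> ^ (j * a mod n))"
    by (simp only: \<chi>_mod \<chi>_mult mult.assoc[symmetric] sq root_pow_mod) (simp add: power_mult)
  also have "\<dots> = of_int (\<chi> j) * (\<Sum>a<n. of_int (\<chi> (j * a mod n)) * \<xi> ^ (j * a mod n))"
    by (simp add: sum_distrib_left mult.assoc)
  also have "(\<Sum>a<n. of_int (\<chi> (j * a mod n)) * \<xi> ^ (j * a mod n)) = gauss_sum"
    unfolding gauss_sum_def
    by (rule sum.reindex_bij_betw[OF bij_betw_mult_mod[OF False], of "\<lambda>a. of_int (\<chi> a) * \<xi> ^ a"])
  finally show ?thesis .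
qed

text \<open>Parseval for the character paired with itself: its transforms at \<open>j\<close> and
  \<open>- j\<close> are \<open>\<chi> j\<close> and \<open>- \<chi> j\<close> times the Gauss sum,
  the sign coming from \<open>\<chi>_minus_one\<close>, and the common factor \<open>n - 1\<close>
  cancels.\<close>

lemma gauss_sum_square: "gauss_sum ^ 2 = - of_nat n"
proof -
  have inv: "(\<Sum>b<n. of_int (\<chi> b) * inverse (\<xi> ^ j) ^ b) = - of_int (\<chi> j) * gauss_sum" for j
    unfolding inverse_root_pow gauss_sum_twist by (simp only: \<chi>_mult \<chi>_minus_one) simp
  have "n - 1 = card Q + card Q"
    using card_Q by simp
  then have sq: "(\<Sum>a<n. of_int (\<chi> a) * of_int (\<chi> a)) = (of_nat (n - 1) :: q2adic alg_closure)"
    using \<chi>_eq_0_iff[of 0] by (simp add: sum_lessThan_n mem_Q_iff mem_N_iff card_N)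
  have nonzero: "of_nat (n - 1) \<noteq> (0 :: q2adic alg_closure)"
    unfolding of_nat_eq_0_iff using n_gt_2 by simp
  have "of_nat n * of_nat (n - 1)
      = (\<Sum>j<n. (of_int (\<chi> j) * gauss_sum) * (- of_int (\<chi> j) * gauss_sum))"
    using parseval[of "\<lambda>a. of_int (\<chi> a)" "\<lambda>a. of_int (\<chi> a)"] unfolding inv gauss_sum_twist sq by simp
  also have "\<dots> = - (gauss_sum ^ 2) * (\<Sum>j<n. of_int (\<chi> j) * of_int (\<chi> j))"
    by (simp add: sum_distrib_left power2_eq_square ac_simps sum_negf)
  also have "\<dots> = - (gauss_sum ^ 2) * of_nat (n - 1)"
    unfolding sq ..
  finally have "of_nat n = - (gauss_sum ^ 2)"
    using nonzero by (simp only: mult_cancel_right simp_thms)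
  then show ?thesis by simp
qed

lemma sum_Q_plus_sum_N: "1 + (\<Sum>j\<in>Q. \<xi> ^ j) + (\<Sum>j\<in>N. \<xi> ^ j) = 0"
  using sum_root_pow[of 1] n_gt_2 by (simp add: sum_lessThan_n)

lemma gauss_sum_eq: "gauss_sum = 1 + 2 * (\<Sum>j\<in>Q. \<xi> ^ j)"
proof -
  have "gauss_sum = (\<Sum>j\<in>Q. \<xi> ^ j) - (\<Sum>j\<in>N. \<xi> ^ j)"
    using \<chi>_eq_0_iff[of 0]
    by (simp add: gauss_sum_def sum_lessThan_n mem_Q_iff mem_N_iff sum_negf)
  also have "(\<Sum>j\<in>N. \<xi> ^ j) = - 1 - (\<Sum>j\<in>Q. \<xi> ^ j)"
    using sum_Q_plus_sum_N by (metis add_diff_cancel_left' diff_0 diff_diff_eq)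
  finally show ?thesis by simp
qed

text \<open>With \<open>n + 1 = 8 * c\<close> and a root \<open>z\<close> of
  \<open>z + 2 * z ^ 2 = - c\<close>, the square of \<open>1 + 4 * z\<close> is
  \<open>1 - 8 * c = - n\<close>, so the Gauss sum is \<open>1 + 4 * z\<close> up to sign.\<close>

lemma sum_Q_in_range: "(\<Sum>j\<in>Q. \<xi> ^ j) \<in> range z2_to_ac"
proof -
  obtain c where c: "n + 1 = 8 * c"
    using n_mod by (intro that[of "(n + 1) div 8"]) presburger
  obtain z :: z2adic where "z = of_int (- int c) + 2 * (of_int 0 * z + of_int (- 1) * z ^ 2)"
    using z2adic_quadratic_fixpoint by blast
  then have z: "z + 2 * z ^ 2 = - of_nat c"
    by (simp add: algebra_simps eq_neg_iff_add_eq_0)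
  have c8: "8 * of_nat c = (of_nat n + 1 :: z2adic)"
    using arg_cong[OF c, of "of_nat :: _ \<Rightarrow> z2adic"] by (simp add: add.commute)
  have "(1 + 4 * z) ^ 2 = 1 + 8 * (z + 2 * z ^ 2)"
    by (simp add: power2_eq_square algebra_simps)
  also have "\<dots> = - of_nat n"
    unfolding z by (simp add: c8)
  finally have "(1 + 4 * z) ^ 2 = - of_nat n" .
  then have "z2_to_ac (1 + 4 * z) ^ 2 = gauss_sum ^ 2"
    unfolding gauss_sum_square by (metis z2_to_ac.hom_power z2_to_ac.hom_uminus z2_to_ac.hom_of_nat)
  then consider "gauss_sum = z2_to_ac (1 + 4 * z)" | "gauss_sum = - z2_to_ac (1 + 4 * z)"
    by (metis power2_eq_iff)
  \<comment> \<open>Either sign gives a number congruent to 1 modulo 2; the factor 2 in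
    \<open>gauss_sum_eq\<close> can then be cancelled within the 2-adic integers.\<close>
  then have "\<exists>y. gauss_sum = z2_to_ac (1 + 2 * y)"
  proof cases
    case 1
    then have "gauss_sum = z2_to_ac (1 + 2 * (2 * z))" by simp
    then show ?thesis ..
  next
    case 2
    then have "gauss_sum = z2_to_ac (- (1 + 4 * z))" by (simp only: z2_to_ac.hom_uminus)
    then have "gauss_sum = z2_to_ac (1 + 2 * (- 1 - 2 * z))" by (simp add: algebra_simps)
    then show ?thesis ..
  qed
  then obtain y where "gauss_sum = z2_to_ac (1 + 2 * y)" ..
  then have "1 + 2 * (\<Sum>j\<in>Q. \<xi> ^ j) = 1 + 2 * z2_to_ac y"
    by (simp only: gauss_sum_eq z2_to_ac_simps z2_to_ac.hom_one)
  then have "(\<Sum>j\<in>Q. \<xi> ^ j) = z2_to_ac y"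
    by (simp only: add_left_cancel mult_cancel_left) simp
  then show ?thesis by simp
qed

end

subsection \<open>Evaluation of 2-adic polynomials\<close>

definition ac_eval :: "z2adic poly \<Rightarrow> q2adic alg_closure \<Rightarrow> q2adic alg_closure" where
  "ac_eval p x = poly (map_poly z2_to_ac p) x"

lemma ac_eval_simps:
  "ac_eval 0 x = 0" "ac_eval 1 x = 1"
  "ac_eval (numeral w) x = numeral w"
  "ac_eval [:c:] x = z2_to_ac c"
  "ac_eval (pCons c p) x = z2_to_ac c + x * ac_eval p x"
  "ac_eval (monom c i) x = z2_to_ac c * x ^ i"
  "ac_eval (smult c p) x = z2_to_ac c * ac_eval p x"
  "ac_eval (p + q) x = ac_eval p x + ac_eval q x"
  "ac_eval (p - q) x = ac_eval p x - ac_eval q x"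
  "ac_eval (- p) x = - ac_eval p x"
  "ac_eval (p * q) x = ac_eval p x * ac_eval q x"
  "ac_eval (p ^ k) x = ac_eval p x ^ k"
  by (simp_all add: ac_eval_def z2_to_ac_poly.hom_add z2_to_ac_poly.hom_mult z2_to_ac_poly.hom_minus
      z2_to_ac_poly.hom_uminus z2_to_ac_poly.hom_power z2_to_ac_poly.hom_numeral
      z2_to_ac.map_poly_pCons_hom z2_to_ac.map_poly_hom_smult poly_monom)

lemma ac_eval_sum: "ac_eval (sum f A) x = (\<Sum>i\<in>A. ac_eval (f i) x)"
  by (induction A rule: infinite_finite_induct) (simp_all add: ac_eval_simps)

lemma ac_eval_pcompose: "ac_eval (pcompose p q) x = ac_eval p (ac_eval q x)"
  by (induction p) (simp_all add: ac_eval_simps pcompose_pCons)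

lemma ac_eval_eq_sum: "ac_eval p x = (\<Sum>i\<le>degree p. z2_to_ac (coeff p i) * x ^ i)"
  by (simp add: ac_eval_def poly_altdef)

lemma finite_ac_eval_roots: "p \<noteq> 0 \<Longrightarrow> finite {x. ac_eval p x = 0}"
  and card_ac_eval_roots: "p \<noteq> 0 \<Longrightarrow> card {x. ac_eval p x = 0} \<le> degree p"
  using poly_roots_finite[of "map_poly z2_to_ac p"] card_poly_roots_bound[of "map_poly z2_to_ac p"]
  by (simp_all add: ac_eval_def)

lemma card_le_degree_if_roots:
  assumes "p \<noteq> 0" "\<And>x. x \<in> S \<Longrightarrow> ac_eval p x = 0"
  shows "card S \<le> degree p"
proof -
  have "card S \<le> card {x. ac_eval p x = 0}"
    using assms by (intro card_mono finite_ac_eval_roots) auto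
  then show ?thesis
    using card_ac_eval_roots[OF assms(1)] by simp
qed

text \<open>Pseudo-division multiplies the dividend by a power of the leading coefficient, which is
  1 here.\<close>

lemma monic_division:
  fixes d :: "'a :: comm_ring_1 poly"
  assumes "lead_coeff d = 1"
  obtains q r where "p = d * q + r" "r = 0 \<or> degree r < degree d"
proof -
  obtain q r where qr: "pseudo_divmod p d = (q, r)" by force
  have "d \<noteq> 0" using assms by auto
  from pseudo_divmod[OF this qr] show ?thesis
    using assms that by auto
qed

text \<open>The remainder modulo \<open>d\<close> vanishes at \<open>card S\<close> points while its
  degree is smaller, hence is zero. Roots in the algebraic closure thus decide divisibility over the
  2-adic integers.\<close>

lemma monic_dvd_iff_roots:
  assumes "lead_coeff d = 1" "degree d = card S" "finite S" "\<And>x. x \<in> S \<Longrightarrow> ac_eval d x = 0"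
  shows "d dvd p \<longleftrightarrow> (\<forall>x\<in>S. ac_eval p x = 0)"
proof
  assume "d dvd p"
  then show "\<forall>x\<in>S. ac_eval p x = 0"
    using assms(4) by (auto simp: ac_eval_simps dvd_def)
next
  assume p: "\<forall>x\<in>S. ac_eval p x = 0"
  obtain q r where pqr: "p = d * q + r" and r: "r = 0 \<or> degree r < degree d"
    using monic_division[OF assms(1)] by blast
  have "ac_eval r x = 0" if "x \<in> S" for x
    using p that assms(4) by (auto simp: pqr ac_eval_simps)
  then have "r = 0"
    using r card_le_degree_if_roots[of r S] assms(2) by fastforce
  then show "d dvd p"
    by (simp add: pqr)
qed

section \<open>Descent and the residue polynomial\<close>

context qr_root_of_unity
begin

text \<open>Depending on the class of \<open>i\<close> modulo \<open>n\<close>, the sum is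
  \<open>card Q\<close>, the sum of \<open>\<xi> ^ j\<close> over the residues, or the one over the
  nonresidues.\<close>

lemma sum_Q_root_pow_in_range: "(\<Sum>r\<in>Q. (\<xi> ^ r) ^ i) \<in> range z2_to_ac"
proof -
  define j where "j = i mod n"
  have j: "(\<xi> ^ r) ^ i = \<xi> ^ (j * r mod n)" for r
    by (metis j_def root_pow_mod mod_mult_left_eq mult.commute power_mult)
  have "j \<in> insert 0 (Q \<union> N)"
    using n_pos by (simp add: j_def flip: lessThan_n_eq)
  then consider "j = 0" | "j \<in> Q" | "j \<in> N"
    by blast
  then show ?thesis
  proof cases
    case 1
    then show ?thesis
      using rangeI[of z2_to_ac "of_nat (card Q)"] by (simp add: j z2_to_ac_simps)
  next
    case 2
    then show ?thesis
      unfolding j using sum_Q_in_range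
      by (simp add: sum.reindex_bij_betw[OF bij_betw_Q_Q, of j "\<lambda>k. \<xi> ^ k"])
  next
    case 3
    obtain y where "(\<Sum>j\<in>Q. \<xi> ^ j) = z2_to_ac y"
      using sum_Q_in_range by blast
    then have "(\<Sum>j\<in>N. \<xi> ^ j) = z2_to_ac (- 1 - y)"
      using sum_Q_plus_sum_N by (simp add: z2_to_ac_simps algebra_simps eq_neg_iff_add_eq_0)
    then show ?thesis
      unfolding j using 3
      by (simp add: sum.reindex_bij_betw[OF bij_betw_Q_N, of j "\<lambda>k. \<xi> ^ k"])
  qed
qed

text \<open>Averaging over the residues replaces Galois descent: their number is odd, hence a 2-adic unit.\<close>

lemma descent:
  assumes "\<And>r. r \<in> Q \<Longrightarrow> ac_eval g (\<xi> ^ r) = c"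
  shows "c \<in> range z2_to_ac"
proof -
  have "\<forall>i. \<exists>y. (\<Sum>r\<in>Q. (\<xi> ^ r) ^ i) = z2_to_ac y"
    using sum_Q_root_pow_in_range by blast
  then obtain w where w: "\<And>i. (\<Sum>r\<in>Q. (\<xi> ^ r) ^ i) = z2_to_ac (w i)"
    using choice[of "\<lambda>i y. (\<Sum>r\<in>Q. (\<xi> ^ r) ^ i) = z2_to_ac y"] by blast
  obtain u :: z2adic where u: "of_nat (card Q) * u = 1"
    using odd_dvd_one_z2adic[OF odd_card_Q] by blast
  have "of_nat (card Q) * c = (\<Sum>r\<in>Q. ac_eval g (\<xi> ^ r))"
    using assms by simp
  also have "\<dots> = (\<Sum>i\<le>degree g. z2_to_ac (coeff g i) * (\<Sum>r\<in>Q. (\<xi> ^ r) ^ i))"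
    unfolding ac_eval_eq_sum sum_distrib_left by (rule sum.swap)
  also have "\<dots> = z2_to_ac (\<Sum>i\<le>degree g. coeff g i * w i)"
    by (simp add: w z2_to_ac_simps)
  finally have "z2_to_ac u * (of_nat (card Q) * c) = z2_to_ac (u * (\<Sum>i\<le>degree g. coeff g i * w i))"
    by (simp add: z2_to_ac_simps)
  moreover have "z2_to_ac u * of_nat (card Q) = 1"
    using arg_cong[OF u, of z2_to_ac] by (simp add: z2_to_ac_simps mult.commute)
  ultimately have "c = z2_to_ac (u * (\<Sum>i\<le>degree g. coeff g i * w i))"
    by (simp flip: mult.assoc)
  then show ?thesis by simp
qed

text \<open>One 2-adic polynomial \<open>g\<close> serves all \<open>x\<close>, so that
  \<open>descent\<close> can compare the values at the powers \<open>\<xi> ^ r\<close>.\<close>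

lemma coeff_prod_linear_is_eval:
  assumes "finite A"
  shows "\<exists>g. \<forall>x. coeff (\<Prod>j\<in>A. [:- (x ^ j), 1:]) m = ac_eval g x"
  using assms
proof (induction A arbitrary: m rule: finite_induct)
  case empty
  then show ?case
    by (intro exI[of _ "if m = 0 then 1 else 0"]) (auto simp: ac_eval_simps)
next
  case (insert j A)
  obtain g where g: "\<And>m x. coeff (\<Prod>j\<in>A. [:- (x ^ j), 1:]) m = ac_eval (g m) x"
    using insert.IH by metis
  \<comment> \<open>Recurrence for the coefficients under multiplication by
    \<open>[:- (x ^ j), 1:]\<close>; at \<open>m = 0\<close> there is no shifted term.\<close>
  define h where "h = monom (- 1) j * g m + (case m of 0 \<Rightarrow> 0 | Suc k \<Rightarrow> g k)"
  have "coeff (\<Prod>j\<in>insert j A. [:- (x ^ j), 1:]) m = ac_eval h x" for x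
    using insert.hyps
    by (simp add: h_def g ac_eval_simps z2_to_ac_simps coeff_pCons split: nat.split)
  then show ?case by blast
qed

definition residue_poly :: "z2adic poly" where
  "residue_poly = map_poly (inv_into UNIV z2_to_ac) (\<Prod>j\<in>Q. [:- (\<xi> ^ j), 1:])"

text \<open>Replacing \<open>\<xi>\<close> by \<open>\<xi> ^ r\<close> for a residue
  \<open>r\<close> permutes the linear factors, so each coefficient descends to a 2-adic
  integer.\<close>

lemma map_residue_poly: "map_poly z2_to_ac residue_poly = (\<Prod>j\<in>Q. [:- (\<xi> ^ j), 1:])"
proof (rule poly_eqI)
  fix m
  obtain g where g: "\<And>x. coeff (\<Prod>j\<in>Q. [:- (x ^ j), 1:]) m = ac_eval g x"
    using coeff_prod_linear_is_eval[OF finite_Q] by blast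
  have "(\<Prod>j\<in>Q. [:- ((\<xi> ^ r) ^ j), 1:]) = (\<Prod>j\<in>Q. [:- (\<xi> ^ j), 1:])" if "r \<in> Q" for r
    using prod.reindex_bij_betw[OF bij_betw_Q_Q[OF that], of "\<lambda>j. [:- (\<xi> ^ j), 1:]"]
    by (simp add: root_pow_mod power_mult)
  then have "coeff (\<Prod>j\<in>Q. [:- (\<xi> ^ j), 1:]) m \<in> range z2_to_ac"
    using descent[of g] by (simp flip: g)
  \<comment> \<open>\<open>map_poly\<close> acts coefficientwise for a function that fixes 0; this
    covers the coefficients beyond the degree.\<close>
  moreover have "inv_into UNIV z2_to_ac 0 = 0"
    by (metis inv_f_f z2_to_ac.hom_zero z2_to_ac.inj_f)
  ultimately show "coeff (map_poly z2_to_ac residue_poly) m = coeff (\<Prod>j\<in>Q. [:- (\<xi> ^ j), 1:]) m"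
    by (simp add: residue_poly_def coeff_map_poly f_inv_into_f)
qed

lemma lead_coeff_residue_poly: "lead_coeff residue_poly = 1"
proof -
  have "lead_coeff (map_poly z2_to_ac residue_poly) = 1"
    unfolding map_residue_poly by (simp add: lead_coeff_prod)
  then show ?thesis by simp
qed

lemma degree_residue_poly: "degree residue_poly = card Q"
proof -
  have "degree (map_poly z2_to_ac residue_poly) = card Q"
    unfolding map_residue_poly by (subst degree_prod_eq_sum_degree) auto
  then show ?thesis by simp
qed

lemma ac_eval_residue_poly_eq_0_iff: "ac_eval residue_poly x = 0 \<longleftrightarrow> (\<exists>j\<in>Q. x = \<xi> ^ j)"
  unfolding ac_eval_def map_residue_poly by (simp add: poly_prod finite_Q)

lemma card_image_root_pow: "A \<subseteq> {..<n} \<Longrightarrow> card ((\<lambda>j. \<xi> ^ j) ` A) = card A"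
  by (intro card_image inj_on_subset[OF inj_on_root_pow])

lemma Q_subset: "Q \<subseteq> {..<n}"
  by (auto simp: mem_Q_iff)

lemma residue_poly_dvd_iff: "residue_poly dvd p \<longleftrightarrow> (\<forall>j\<in>Q. ac_eval p (\<xi> ^ j) = 0)"
  by (subst monic_dvd_iff_roots[where S = "(\<lambda>j. \<xi> ^ j) ` Q"])
    (auto simp: lead_coeff_residue_poly[unfolded degree_residue_poly] degree_residue_poly card_image_root_pow Q_subset finite_Q
      ac_eval_residue_poly_eq_0_iff)

lemma degree_monom_minus_one: "degree (monom 1 n - 1 :: z2adic poly) = n"
  and lead_coeff_monom_minus_one: "lead_coeff (monom 1 n - 1 :: z2adic poly) = 1"
proof -
  show "degree (monom 1 n - 1 :: z2adic poly) = n"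
    using n_pos degree_add_eq_left[of "- 1" "monom 1 n :: z2adic poly"] by (simp add: degree_monom_eq)
  then show "lead_coeff (monom 1 n - 1 :: z2adic poly) = 1"
    using n_pos by simp
qed

lemma cyclic_dvd_iff: "monom 1 n - 1 dvd p \<longleftrightarrow> (\<forall>j<n. ac_eval p (\<xi> ^ j) = 0)"
proof -
  have "(\<xi> ^ j) ^ n = 1" for j
    by (metis power_mult mult.commute root_pow_n power_one)
  then show ?thesis
    using lead_coeff_monom_minus_one degree_monom_minus_one
    by (subst monic_dvd_iff_roots[where S = "(\<lambda>j. \<xi> ^ j) ` {..<n}"])
      (auto simp: card_image_root_pow ac_eval_simps)
qed

lemma residue_poly_dvd_cyclic: "residue_poly dvd monom 1 n - 1"
  unfolding residue_poly_dvd_iff using cyclic_dvd_iff[of "monom 1 n - 1"] Q_subset by auto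

subsection \<open>Irreducibility\<close>

text \<open>The norm of \<open>1 - 2 h(\<xi>)\<close> would be a 2-adic integer that is odd and zero.\<close>

lemma half_not_integral: "2 * ac_eval h \<xi> \<noteq> 1"
proof
  assume h: "2 * ac_eval h \<xi> = 1"
  \<comment> \<open>Products of factors \<open>1 - 2 * a\<close> keep this form, since
    \<open>(1 - 2 * a) * (1 - 2 * b) = 1 - 2 * (a + b - 2 * a * b)\<close>.\<close>
  have "\<exists>H. \<forall>x. (\<Prod>r\<in>A. 1 - 2 * ac_eval h (x ^ r)) = 1 - 2 * ac_eval H x" if "finite A" for A
    using that
  proof (induction A rule: finite_induct)
    case empty
    then show ?case by (intro exI[of _ 0]) (simp add: ac_eval_simps)
  next
    case (insert r A)
    then obtain H where H: "\<And>x. (\<Prod>r\<in>A. 1 - 2 * ac_eval h (x ^ r)) = 1 - 2 * ac_eval H x"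
      by blast
    define k where "k = pcompose h (monom 1 r)"
    have "(\<Prod>r\<in>insert r A. 1 - 2 * ac_eval h (x ^ r)) = 1 - 2 * ac_eval (k + H - 2 * k * H) x" for x
      using insert.hyps by (simp add: H k_def ac_eval_simps ac_eval_pcompose algebra_simps)
    then show ?case by blast
  qed
  then obtain H where H: "\<And>x. (\<Prod>r\<in>Q. 1 - 2 * ac_eval h (x ^ r)) = 1 - 2 * ac_eval H x"
    using finite_Q by blast
  have "ac_eval H (\<xi> ^ q) = 1 / 2" if "q \<in> Q" for q
  proof -
    have "(\<Prod>r\<in>Q. 1 - 2 * ac_eval h ((\<xi> ^ q) ^ r)) = (\<Prod>r\<in>Q. 1 - 2 * ac_eval h (\<xi> ^ r))"
      using prod.reindex_bij_betw[OF bij_betw_Q_Q[OF that], of "\<lambda>r. 1 - 2 * ac_eval h (\<xi> ^ r)"]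
      by (simp add: root_pow_mod power_mult)
    \<comment> \<open>The residue 1 contributes the factor \<open>1 - 2 * ac_eval h \<xi>\<close>,
      which is zero.\<close>
    also have "\<dots> = 0"
      using one_in_Q h finite_Q by (auto intro!: prod_zero bexI[of _ 1])
    finally show ?thesis
      by (simp add: H eq_divide_eq mult.commute)
  qed
  then obtain y where "1 / 2 = z2_to_ac y"
    using descent[of H "1 / 2"] by blast
  then have "z2_to_ac (2 * y) = 1"
    by (simp add: z2_to_ac_simps flip: \<open>1 / 2 = z2_to_ac y\<close>)
  then show False
    using two_not_dvd_one_z2adic by simp
qed

text \<open>Otherwise the cofactor \<open>g\<close> vanishes at \<open>\<xi> ^ 2\<close>, and
  \<open>pcompose_square_cong_z2adic\<close> makes the square of g(\<xi>) a multiple of 2. But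
  differentiating \<open>f * g\<close> at the root \<open>\<xi>\<close> of \<open>f\<close> shows
  that g(\<xi>) is a unit of the ring generated by \<open>\<xi>\<close>, so 2 would be a unit
  too.\<close>

lemma cyclic_factor_root_square:
  assumes fg: "f * g = monom 1 n - 1" and f: "ac_eval f \<xi> = 0"
  shows "ac_eval f (\<xi> ^ 2) = 0"
proof (rule ccontr)
  assume "ac_eval f (\<xi> ^ 2) \<noteq> 0"
  moreover have "ac_eval f (\<xi> ^ 2) * ac_eval g (\<xi> ^ 2) = 0"
    using arg_cong[OF fg, of "\<lambda>p. ac_eval p (\<xi> ^ 2)"]
    by (simp add: ac_eval_simps root_pow_n flip: power_mult) (simp add: mult.commute power_mult root_pow_n)
  ultimately have "ac_eval g (\<xi> ^ 2) = 0"
    by simp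
  moreover obtain h where "pcompose g (monom 1 2) = g ^ 2 + 2 * h"
    using pcompose_square_cong_z2adic by blast
  from arg_cong[OF this, of "\<lambda>p. ac_eval p \<xi>"]
  have "ac_eval g (\<xi> ^ 2) = ac_eval g \<xi> ^ 2 + 2 * ac_eval h \<xi>"
    by (simp add: ac_eval_simps ac_eval_pcompose)
  ultimately have g2: "ac_eval g \<xi> ^ 2 = - 2 * ac_eval h \<xi>"
    by (simp add: eq_neg_iff_add_eq_0)
  obtain u :: z2adic where u: "of_nat n * u = 1"
    using odd_dvd_one_z2adic[OF odd_n] by blast
  have u': "of_nat n * z2_to_ac u = 1"
    using arg_cong[OF u, of z2_to_ac] by (simp add: z2_to_ac_simps)
  have "pderiv f * g + f * pderiv g = monom (of_nat n) (n - 1)"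
    using arg_cong[OF fg, of pderiv] by (simp add: pderiv_mult pderiv_monom pderiv_diff algebra_simps)
  from arg_cong[OF this, of "\<lambda>p. ac_eval p \<xi>"]
  have "ac_eval (pderiv f) \<xi> * ac_eval g \<xi> = of_nat n * \<xi> ^ (n - 1)"
    using f by (simp add: ac_eval_simps z2_to_ac_simps)
  \<comment> \<open>The factor \<open>monom u 1\<close>, with \<open>u\<close> inverse to
    \<open>n\<close>, turns the right-hand side into \<open>\<xi> ^ n = 1\<close>.\<close>
  then have "ac_eval (monom u 1 * pderiv f) \<xi> * ac_eval g \<xi> = (of_nat n * z2_to_ac u) * (\<xi> * \<xi> ^ (n - 1))"
    by (simp add: ac_eval_simps)
  also have "\<dots> = 1"
    using u' root_pow_n n_pos by (simp flip: power_Suc)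
  finally have "(ac_eval (monom u 1 * pderiv f) \<xi> * ac_eval g \<xi>) ^ 2 = 1"
    by simp
  then have "2 * ac_eval (- ((monom u 1 * pderiv f) ^ 2 * h)) \<xi> = 1"
    by (simp add: power_mult_distrib g2 ac_eval_simps ac_simps)
  then show False
    using half_not_integral by blast
qed

text \<open>As \<open>n\<close> is prime, every nontrivial power is again a primitive root, at which
  the locale can be interpreted.\<close>

lemma root_pow_setup:
  assumes "\<not> n dvd j"
  shows "qr_root_of_unity n (\<xi> ^ j)"
proof
  have "(\<xi> ^ j) ^ k = 1 \<longleftrightarrow> n dvd k" for k
    using assms prime_n by (simp add: root_pow_eq_1_iff prime_dvd_mult_iff flip: power_mult)
  then show "primitive_root_of_unity n (\<xi> ^ j)"
    unfolding primitive_root_of_unity_def using n_pos by (auto dest: dvd_imp_le)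
qed (fact prime_n n_mod)+

lemma not_dvd_two_pow: "\<not> n dvd 2 ^ i"
proof
  assume "n dvd 2 ^ i"
  then have "n dvd 2"
    using prime_n prime_dvd_power by blast
  then show False
    using n_gt_2 by (auto dest: dvd_imp_le)
qed

text \<open>From one root of \<open>f\<close>, repeated squaring yields \<open>ord n 2\<close>
  distinct roots. This is the full degree of \<open>residue_poly\<close>, so \<open>g\<close> is
  constant, and comparing leading coefficients makes it a unit.\<close>

lemma residue_poly_factor_is_unit:
  assumes fg: "residue_poly = f * g" and deg: "degree f > 0" and ord: "ord n 2 = (n - 1) div 2"
  shows "g dvd 1"
proof -
  have "degree (map_poly z2_to_ac f) > 0" using deg by simp
  then obtain x where x: "ac_eval f x = 0"
    unfolding ac_eval_def using alg_closed_imp_poly_has_root by blast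
  then have "ac_eval residue_poly x = 0"
    by (simp add: fg ac_eval_simps)
  then obtain j where j: "j \<in> Q" "x = \<xi> ^ j"
    by (auto simp: ac_eval_residue_poly_eq_0_iff)
  have ndvd: "\<not> n dvd j * 2 ^ i" for i
    using j(1) \<chi>_eq_0_iff[of j] not_dvd_two_pow prime_n by (simp add: prime_dvd_mult_iff mem_Q_iff)
  obtain g' where fg': "f * g' = monom 1 n - 1"
    using residue_poly_dvd_cyclic unfolding fg dvd_def mult.assoc by metis
  have root: "ac_eval f (\<xi> ^ (j * 2 ^ i)) = 0" for i
  proof (induction i)
    case 0
    then show ?case using x j by simp
  next
    case (Suc i)
    interpret pow: qr_root_of_unity n "\<xi> ^ (j * 2 ^ i)"
      using ndvd by (rule root_pow_setup)
    show ?case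
      using pow.cyclic_factor_root_square[OF fg' Suc] by (simp add: ac_simps flip: power_mult)
  qed
  have "inj_on (\<lambda>i. \<xi> ^ (j * 2 ^ i)) {..<ord n 2}"
  proof (rule inj_onI)
    fix a b assume ab: "a \<in> {..<ord n 2}" "b \<in> {..<ord n 2}" and "\<xi> ^ (j * 2 ^ a) = \<xi> ^ (j * 2 ^ b)"
    then have "[j * 2 ^ a = j * 2 ^ b] (mod n)"
      by (simp add: root_pow_eq_iff)
    moreover have "coprime j n"
      using ndvd[of 0] prime_imp_coprime[OF prime_n, of j] by (simp add: coprime_commute)
    ultimately have "[2 ^ a = 2 ^ b] (mod n)"
      by (simp add: cong_mult_lcancel_nat)
    moreover have "coprime n 2"
      using not_dvd_two_pow[of 1] prime_imp_coprime[OF prime_n, of 2] by simp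
    ultimately show "a = b"
      using ab order_divides_expdiff[of n 2 a b] by (simp add: cong_less_modulus_unique_nat)
  qed
  then have "card Q = card ((\<lambda>i. \<xi> ^ (j * 2 ^ i)) ` {..<ord n 2})"
    using card_Q by (simp add: card_image ord)
  also have "\<dots> \<le> degree f"
    using root deg by (intro card_le_degree_if_roots) auto
  finally have "card Q \<le> degree f" .
  moreover have fg0: "f \<noteq> 0" "g \<noteq> 0"
    using lead_coeff_residue_poly by (auto simp: fg)
  then have "degree f + degree g = card Q"
    using degree_mult_eq[of f g] degree_residue_poly fg by simp
  ultimately have "degree g = 0" by simp
  moreover have "lead_coeff f * lead_coeff g = 1"
    using lead_coeff_residue_poly by (simp add: fg lead_coeff_mult)
  ultimately show ?thesis
    by (metis degree_0_id dvd_triv_right is_unit_const_poly_iff)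
qed

lemma irreducible_residue_poly:
  assumes "ord n 2 = (n - 1) div 2"
  shows "Factorial_Ring.irreducible residue_poly"
proof (rule Factorial_Ring.irreducibleI)
  show "residue_poly \<noteq> 0"
    using lead_coeff_residue_poly by auto
  have "degree residue_poly \<noteq> 0"
    using one_in_Q finite_Q by (auto simp: degree_residue_poly)
  then show "\<not> residue_poly dvd 1"
    by (auto simp: is_unit_poly_iff)
  fix f g assume fg: "residue_poly = f * g"
  show "f dvd 1 \<or> g dvd 1"
  proof (cases "degree f = 0")
    case True
    moreover have "lead_coeff f * lead_coeff g = 1"
      using lead_coeff_residue_poly by (simp add: fg lead_coeff_mult)
    ultimately show ?thesis
      by (metis degree_0_id dvd_triv_left is_unit_const_poly_iff)
  next
    case False
    then show ?thesis
      using residue_poly_factor_is_unit[OF fg] assms by simp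
  qed
qed

end

subsection \<open>Idempotents of the cyclic ring\<close>

lemma cyc_class_eq_iff: "cyc_class n f = cyc_class n g \<longleftrightarrow> monom 1 n - 1 dvd f - g"
proof
  assume "cyc_class n f = cyc_class n g"
  moreover have "f \<in> cyc_class n f"
    by (simp add: cyc_class_iff)
  ultimately show "monom 1 n - 1 dvd f - g"
    by (simp add: cyc_class_iff)
next
  assume fg: "monom 1 n - 1 dvd f - g"
  have "monom 1 n - 1 dvd h - f \<longleftrightarrow> monom 1 n - 1 dvd h - g" for h
    using dvd_add_left_iff[OF fg, of "h - f"] by simp
  then show "cyc_class n f = cyc_class n g"
    by (auto simp: cyc_class_iff)
qed

lemma carrier_cyc_ring: "carrier (cyc_ring n) = range (cyc_class n)"
  by (auto simp: cyc_ring_def FactRing_def A_RCOSETS_def RCOSETS_def cyc_class_def a_r_coset_def)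

text \<open>Multiplication in the quotient is defined as a union of cosets over all pairs of
  representatives; these cosets coincide.\<close>

lemma cyc_ring_mult: "cyc_class n f \<otimes>\<^bsub>cyc_ring n\<^esub> cyc_class n g = cyc_class n (f * g)"
proof -
  have "cyc_class n (a * b) = cyc_class n (f * g)" if "a \<in> cyc_class n f" "b \<in> cyc_class n g" for a b
  proof -
    have "monom 1 n - 1 dvd (a - f) * b + f * (b - g)"
      using that by (intro dvd_add dvd_mult dvd_mult2) (simp_all add: cyc_class_iff)
    then show ?thesis
      by (simp add: cyc_class_eq_iff algebra_simps)
  qed
  moreover have "f \<in> cyc_class n f" "g \<in> cyc_class n g"
    by (simp_all add: cyc_class_iff)
  ultimately have "(\<Union>a\<in>cyc_class n f. \<Union>b\<in>cyc_class n g. cyc_class n (a * b)) = cyc_class n (f * g)"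
    by blast
  then show ?thesis
    by (simp add: cyc_ring_def FactRing_def rcoset_mult_def cyc_class_def)
qed

lemma PIdl_cyc_ring: "PIdl\<^bsub>cyc_ring n\<^esub> (cyc_class n f) = range (\<lambda>h. cyc_class n (h * f))"
proof -
  have "PIdl\<^bsub>cyc_ring n\<^esub> (cyc_class n f)
      = (\<lambda>c. c \<otimes>\<^bsub>cyc_ring n\<^esub> cyc_class n f) ` range (cyc_class n)"
    unfolding cgenideal_def carrier_cyc_ring by blast
  then show ?thesis
    by (simp add: image_image cyc_ring_mult)
qed

lemma generated_by_idempotent_cyc_ringI:
  assumes "monom 1 n - 1 dvd e * e - e" "monom 1 n - 1 dvd e - x * f" "monom 1 n - 1 dvd f - y * e"
  shows "generated_by_idempotent (cyc_ring n) (PIdl\<^bsub>cyc_ring n\<^esub> (cyc_class n f)) (cyc_class n e)"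
proof -
  have "cyc_class n (h * f) = cyc_class n (h * y * e)" for h
    using dvd_mult[OF assms(3), of h] by (simp add: cyc_class_eq_iff algebra_simps)
  moreover have "cyc_class n (h * e) = cyc_class n (h * x * f)" for h
    using dvd_mult[OF assms(2), of h] by (simp add: cyc_class_eq_iff algebra_simps)
  ultimately have "PIdl\<^bsub>cyc_ring n\<^esub> (cyc_class n f) = PIdl\<^bsub>cyc_ring n\<^esub> (cyc_class n e)"
    unfolding PIdl_cyc_ring by blast
  then show ?thesis
    using assms(1) rangeI[of "cyc_class n" e]
    by (simp add: generated_by_idempotent_def carrier_cyc_ring cyc_ring_mult cyc_class_eq_iff)
qed

lemma cyc_coeffs_spec:
  assumes "n > 0"
  shows "cyc_coeffs n (cyc_class n f) \<in> carrier_vec n"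
    and "monom 1 n - 1 dvd Poly (list_of_vec (cyc_coeffs n (cyc_class n f))) - f"
  using theI'[OF cyc_coeffs_unique[OF assms, of f]] by (simp_all add: cyc_coeffs_def cyc_class_iff)

lemma ac_eval_Poly: "ac_eval (Poly xs) x = (\<Sum>i<length xs. z2_to_ac (xs ! i) * x ^ i)"
  by (induction xs)
    (simp_all add: ac_eval_simps sum.lessThan_Suc_shift sum_distrib_left ac_simps del: sum.lessThan_Suc)

section \<open>Values of the idempotents at the roots of unity\<close>

context qr_root_of_unity
begin

definition char_comb :: "z2adic \<Rightarrow> z2adic \<Rightarrow> z2adic \<Rightarrow> z2adic poly" where
  "char_comb a b c = [:a:] + smult b (\<Sum>i\<in>Q. monom 1 i) + smult c (\<Sum>i\<in>N. monom 1 i)"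

text \<open>Values 0 and 1 at all powers of \<open>\<xi>\<close> make \<open>e\<close> idempotent.
  Its zeros include the roots of the monic \<open>d\<close>, so \<open>d\<close> divides
  \<open>e\<close>; conversely \<open>d\<close> and \<open>d * e\<close> have the same values, hence
  the same class.\<close>

lemma generated_by_idempotentI:
  assumes "A \<subseteq> {..<n}" "lead_coeff d = 1" "degree d = card A"
    and d: "\<And>j. j \<in> A \<Longrightarrow> ac_eval d (\<xi> ^ j) = 0"
    and e: "\<And>j. j < n \<Longrightarrow> ac_eval e (\<xi> ^ j) = (if j \<in> A then 0 else 1)"
  shows "generated_by_idempotent (cyc_ring n) (PIdl\<^bsub>cyc_ring n\<^esub> (cyc_class n d)) (cyc_class n e)"
proof -
  have "d dvd e"
    using assms finite_subset[OF assms(1)]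
    by (subst monic_dvd_iff_roots[where S = "(\<lambda>j. \<xi> ^ j) ` A"]) (auto simp: card_image_root_pow)
  then obtain x where x: "e = x * d"
    by (auto simp: dvd_def mult.commute)
  show ?thesis
  proof (rule generated_by_idempotent_cyc_ringI)
    show "monom 1 n - 1 dvd e * e - e" "monom 1 n - 1 dvd d - d * e"
      using d e by (auto simp: cyclic_dvd_iff ac_eval_simps)
    show "monom 1 n - 1 dvd e - x * d"
      by (simp add: x)
  qed
qed

lemma sum_Q_pow: "(\<Sum>i\<in>Q. (\<xi> ^ j) ^ i) = (if \<chi> j = 0 then of_nat (card Q)
    else if \<chi> j = 1 then (\<Sum>i\<in>Q. \<xi> ^ i) else (\<Sum>i\<in>N. \<xi> ^ i))"
proof -
  define r where "r = j mod n"
  have r: "r < n" "\<chi> r = \<chi> j" "(\<xi> ^ j) ^ i = \<xi> ^ (r * i mod n)" for i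
    using n_pos unfolding r_def \<chi>_mod root_pow_mod
    by (simp_all add: power_mult root_pow_mod)
  have "\<chi> j = 0 \<or> \<chi> j = 1 \<or> \<chi> j = - 1"
    by (simp add: Legendre_def)
  moreover have "r = 0" if "\<chi> j = 0"
    using that by (simp add: r_def \<chi>_eq_0_iff)
  ultimately show ?thesis
    using r by (auto simp: mem_Q_iff mem_N_iff sum.reindex_bij_betw[OF bij_betw_Q_Q, of r "\<lambda>k. \<xi> ^ k"]
        sum.reindex_bij_betw[OF bij_betw_Q_N, of r "\<lambda>k. \<xi> ^ k"])
qed

lemma sum_N_pow: "(\<Sum>i\<in>N. (\<xi> ^ j) ^ i) = (if \<chi> j = 0 then of_nat (card Q)
    else if \<chi> j = 1 then (\<Sum>i\<in>N. \<xi> ^ i) else (\<Sum>i\<in>Q. \<xi> ^ i))"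
proof -
  have "(\<Sum>i<n. (\<xi> ^ j) ^ i) = (if \<chi> j = 0 then of_nat n else 0)"
    by (simp add: sum_root_pow \<chi>_eq_0_iff)
  then have eq: "1 + (\<Sum>i\<in>Q. (\<xi> ^ j) ^ i) + (\<Sum>i\<in>N. (\<xi> ^ j) ^ i) = (if \<chi> j = 0 then of_nat n else 0)"
    by (simp add: sum_lessThan_n)
  have n: "of_nat n = (2 * of_nat (card Q) + 1 :: q2adic alg_closure)"
    using arg_cong[OF card_Q, of "of_nat :: _ \<Rightarrow> q2adic alg_closure"] by (simp add: add.commute)
  show ?thesis
  proof (cases "\<chi> j = 0")
    case True
    then show ?thesis
      using eq unfolding sum_Q_pow n mult_2 by simp
  next
    case False
    then have "1 + (\<Sum>i\<in>Q. (\<xi> ^ j) ^ i) + (\<Sum>i\<in>N. (\<xi> ^ j) ^ i) = 1 + (\<Sum>i\<in>Q. \<xi> ^ i) + (\<Sum>i\<in>N. \<xi> ^ i)"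
      using eq sum_Q_plus_sum_N by simp
    then show ?thesis
      using False by (auto simp: sum_Q_pow)
  qed
qed

text \<open>The Gaussian period of the residues. The number s of the theorem is
  \<open>1 + 2 * period\<close>, and the period avoids its halves in the coefficients of the
  idempotents.\<close>

definition period :: z2adic where
  "period = inv_into UNIV z2_to_ac (\<Sum>j\<in>Q. \<xi> ^ j)"

lemma z2_to_ac_period: "z2_to_ac period = (\<Sum>j\<in>Q. \<xi> ^ j)"
  unfolding period_def using sum_Q_in_range by (rule f_inv_into_f)

lemma sum_N_eq_period: "(\<Sum>j\<in>N. \<xi> ^ j) = z2_to_ac (- 1 - period)"
  using sum_Q_plus_sum_N by (simp add: z2_to_ac_simps z2_to_ac_period algebra_simps eq_neg_iff_add_eq_0)

lemma period_square: "(1 + 2 * period) ^ 2 = - of_nat n"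
proof -
  have "z2_to_ac ((1 + 2 * period) ^ 2) = z2_to_ac (- of_nat n)"
    using gauss_sum_square by (simp add: gauss_sum_eq z2_to_ac_simps z2_to_ac_period)
  then show ?thesis by (simp only: z2_to_ac.eq_iff)
qed

lemma of_nat_n: "of_nat n = (2 * of_nat (card Q) + 1 :: z2adic)"
  using arg_cong[OF card_Q, of "of_nat :: _ \<Rightarrow> z2adic"] by (simp add: add.commute)

lemma period_quadratic: "2 * (period + period ^ 2) = - of_nat (card Q) - 1"
proof -
  have "2 * (2 * (period + period ^ 2)) = (1 + 2 * period) ^ 2 - 1"
    by (simp add: power2_eq_square algebra_simps)
  also have "\<dots> = 2 * (- of_nat (card Q) - 1)"
    by (simp add: period_square of_nat_n)
  finally show ?thesis
    by (simp only: mult_cancel_left) simp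
qed

lemma ac_eval_char_comb:
  "ac_eval (char_comb a b c) (\<xi> ^ j) = z2_to_ac
     (if \<chi> j = 0 then a + of_nat (card Q) * (b + c)
      else if \<chi> j = 1 then a + b * period + c * (- 1 - period)
      else a + b * (- 1 - period) + c * period)"
  unfolding char_comb_def ac_eval_simps ac_eval_sum z2_to_ac.hom_one mult_1_left sum_Q_pow sum_N_pow
    sum_N_eq_period z2_to_ac_period[symmetric]
  by (simp add: z2_to_ac_simps algebra_simps)

definition n_inv :: z2adic where
  "n_inv = (SOME u. of_nat n * u = 1)"

lemma n_inv: "of_nat n * n_inv = 1"
  unfolding n_inv_def using odd_dvd_one_z2adic[OF odd_n] by (rule someI_ex)

lemma n_inv': "n_inv * (2 * of_nat (card Q) + 1) = 1"
  using n_inv by (simp add: of_nat_n mult.commute)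

text \<open>With q for \<open>card Q\<close>, so that n = 2q + 1, and s = 1 + 2
  \<open>period\<close>, a factor 2 cancels in the stated fractions: (n + 1)/(2n) = (q + 1)/n, (1 +
  s)/(2n) = (1 + period)/n and (1 - s)/(2n) = -period/n.\<close>

definition idem1 :: "z2adic poly" where
  "idem1 = char_comb ((of_nat (card Q) + 1) * n_inv) ((1 + period) * n_inv) (- period * n_inv)"

definition idem2 :: "z2adic poly" where
  "idem2 = char_comb (of_nat (card Q) * n_inv) (period * n_inv) ((- 1 - period) * n_inv)"

lemma \<chi>_cases: "\<chi> j = 0 \<or> \<chi> j = 1 \<or> \<chi> j = - 1"
  by (simp add: Legendre_def)

lemma n_inv_period:
  "n_inv * (of_nat (card Q) + 1 + 2 * (period + period ^ 2)) = 0"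
  "n_inv * (of_nat (card Q) - 2 * (period + period ^ 2)) = 1"
  unfolding period_quadratic using n_inv' by (simp_all add: algebra_simps)

lemma ac_eval_idem1: "ac_eval idem1 (\<xi> ^ j) = (if \<chi> j = 1 then 0 else 1)"
proof -
  let ?q = "of_nat (card Q) :: z2adic"
  \<comment> \<open>The three identities treat \<open>\<chi> j\<close> equal to 0, 1 and -1, with
    values 1, 0 and 1.\<close>
  have "(?q + 1) * n_inv + ?q * ((1 + period) * n_inv + - period * n_inv) = n_inv * (2 * ?q + 1)"
    by (simp add: algebra_simps)
  moreover have "(?q + 1) * n_inv + (1 + period) * n_inv * period + - period * n_inv * (- 1 - period)
      = n_inv * (?q + 1 + 2 * (period + period ^ 2))"
    by (simp add: power2_eq_square algebra_simps)
  moreover have "(?q + 1) * n_inv + (1 + period) * n_inv * (- 1 - period) + - period * n_inv * period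
      = n_inv * (?q - 2 * (period + period ^ 2))"
    by (simp add: power2_eq_square algebra_simps)
  ultimately show ?thesis
    unfolding idem1_def ac_eval_char_comb by (simp only: n_inv' n_inv_period) simp
qed

lemma ac_eval_idem2: "ac_eval idem2 (\<xi> ^ j) = (if \<chi> j = - 1 then 1 else 0)"
proof -
  let ?q = "of_nat (card Q) :: z2adic"
  have "?q * n_inv + ?q * (period * n_inv + (- 1 - period) * n_inv) = 0"
    by (simp add: algebra_simps)
  moreover have "?q * n_inv + period * n_inv * period + (- 1 - period) * n_inv * (- 1 - period)
      = n_inv * (?q + 1 + 2 * (period + period ^ 2))"
    by (simp add: power2_eq_square algebra_simps)
  moreover have "?q * n_inv + period * n_inv * (- 1 - period) + (- 1 - period) * n_inv * period
      = n_inv * (?q - 2 * (period + period ^ 2))"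
    by (simp add: power2_eq_square algebra_simps)
  ultimately show ?thesis
    unfolding idem2_def ac_eval_char_comb using \<chi>_cases[of j]
    by (simp only: n_inv_period) auto
qed

lemma idem1_generates:
  "generated_by_idempotent (cyc_ring n) (PIdl\<^bsub>cyc_ring n\<^esub> (cyc_class n residue_poly)) (cyc_class n idem1)"
  using lead_coeff_residue_poly degree_residue_poly
  by (intro generated_by_idempotentI[of Q])
    (auto simp: Q_subset ac_eval_residue_poly_eq_0_iff ac_eval_idem1 mem_Q_iff)

lemma idem2_generates:
  "generated_by_idempotent (cyc_ring n)
    (PIdl\<^bsub>cyc_ring n\<^esub> (cyc_class n ([:- 1, 1:] * residue_poly))) (cyc_class n idem2)"
proof (rule generated_by_idempotentI[of "insert 0 Q"])
  show "insert 0 Q \<subseteq> {..<n}"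
    using Q_subset n_pos by simp
  have "lead_coeff ([:- 1, 1:] * residue_poly) = 1"
    unfolding lead_coeff_mult lead_coeff_residue_poly by simp
  then show "lead_coeff ([:- 1, 1:] * residue_poly) = 1" .
  have "residue_poly \<noteq> 0"
    using lead_coeff_residue_poly by auto
  then have "degree ([:- 1, 1:] * residue_poly) = 1 + card Q"
    by (subst degree_mult_eq) (simp_all add: degree_residue_poly)
  then show "degree ([:- 1, 1:] * residue_poly) = card (insert 0 Q)"
    using finite_Q zero_notin by simp
  fix j
  show "ac_eval ([:- 1, 1:] * residue_poly) (\<xi> ^ j) = 0" if "j \<in> insert 0 Q"
    using that ac_eval_residue_poly_eq_0_iff by (auto simp: ac_eval_simps z2_to_ac_simps)
  show "ac_eval idem2 (\<xi> ^ j) = (if j \<in> insert 0 Q then 0 else 1)" if "j < n"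
    using that \<chi>_cases[of j] \<chi>_eq_0_iff[of j] \<chi>_eq_0_iff[of 0]
    by (auto simp: ac_eval_idem2 mem_Q_iff dest: dvd_imp_le)
qed

end

subsection \<open>Codes\<close>

no_notation fps_nth (infixl "$" 75)

lemma linear_codeI:
  fixes D :: "'a :: comm_ring_1 vec set"
  assumes "D \<subseteq> carrier_vec m" "0\<^sub>v m \<in> D"
    and "\<And>v w. v \<in> D \<Longrightarrow> w \<in> D \<Longrightarrow> v + w \<in> D" "\<And>c v. v \<in> D \<Longrightarrow> c \<cdot>\<^sub>v v \<in> D"
  shows "linear_code m D"
proof -
  interpret V: vec_module "TYPE('a)" m .
  show ?thesis
    unfolding linear_code_def using assms
    by (intro submodule.intro V.module_axioms) (auto simp: module_vec_simps)
qed

lemma linear_codeD: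
  fixes D :: "'a :: comm_ring_1 vec set"
  assumes "linear_code m D"
  shows "D \<subseteq> carrier_vec m" "0\<^sub>v m \<in> D"
    "v \<in> D \<Longrightarrow> w \<in> D \<Longrightarrow> v + w \<in> D" "v \<in> D \<Longrightarrow> c \<cdot>\<^sub>v v \<in> D"
  using submodule.subset[OF assms[unfolded linear_code_def]]
    submodule.zero_closed[OF assms[unfolded linear_code_def]]
    submodule.m_closed[OF assms[unfolded linear_code_def]]
    submodule.smult_closed[OF assms[unfolded linear_code_def]]
  by (simp_all add: module_vec_simps)

lemma linear_code_sum:
  fixes D :: "'a :: comm_ring_1 vec set"
  assumes D: "linear_code m D" and "finite A" "\<And>i. i \<in> A \<Longrightarrow> f i \<in> D"
  shows "vec m (\<lambda>k. \<Sum>i\<in>A. c i * f i $ k) \<in> D"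
  using assms(2,3)
proof (induction A rule: finite_induct)
  case empty
  have "vec m (\<lambda>k. \<Sum>i\<in>{}. c i * f i $ k) = 0\<^sub>v m" by auto
  then show ?case using linear_codeD(2)[OF D] by metis
next
  case (insert j A)
  have "f j \<in> carrier_vec m"
    using linear_codeD(1)[OF D] insert.prems by auto
  then have "vec m (\<lambda>k. \<Sum>i\<in>insert j A. c i * f i $ k) = c j \<cdot>\<^sub>v f j + vec m (\<lambda>k. \<Sum>i\<in>A. c i * f i $ k)"
    using insert.hyps by (intro eq_vecI) auto
  then show ?case
    using linear_codeD(3,4)[OF D] insert by simp
qed

lemma linear_code_span:
  fixes S :: "'a :: comm_ring_1 vec set"
  assumes "S \<subseteq> carrier_vec m"
  shows "linear_code m (code_span m S)" "S \<subseteq> code_span m S"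
proof -
  interpret V: vec_module "TYPE('a)" m .
  show "linear_code m (code_span m S)"
    unfolding linear_code_def code_span_def using assms by (rule V.span_is_submodule)
  show "S \<subseteq> code_span m S"
    unfolding code_span_def using assms by (rule V.in_own_span)
qed

lemma code_span_subset:
  fixes S :: "'a :: comm_ring_1 vec set"
  assumes "S \<subseteq> D" "linear_code m D"
  shows "code_span m S \<subseteq> D"
proof -
  interpret V: vec_module "TYPE('a)" m .
  show ?thesis
    unfolding code_span_def using assms by (intro V.span_is_subset) (simp_all add: linear_code_def)
qed

text \<open>The vectors \<open>d l\<close> are in systematic form on the coordinates
  \<open>p 0, ..., p (k - 1)\<close>; their remaining coordinates make up the block
  \<open>A\<close>.\<close>

lemma has_type_oneI:
  fixes d :: "nat \<Rightarrow> 'a :: comm_ring_1 vec"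
  assumes k: "k \<le> m" and p: "p permutes {..<m}"
    and d: "\<And>i l. i < k \<Longrightarrow> l < k \<Longrightarrow> d l $ p i = (if i = l then 1 else 0)"
    and D: "D = range (\<lambda>c. vec m (\<lambda>i. \<Sum>l<k. c l * d l $ i))"
  shows "has_type_one m k D"
proof -
  define A where "A = mat k (m - k) (\<lambda>(l, i). d l $ p (k + i))"
  define G where "G = standard_gen_mat m k A"
  have dims: "dim_row G = k" "dim_col G = m"
    using k by (simp_all add: G_def standard_gen_mat_def A_def)
  have G: "G $$ (l, i) = d l $ p i" if "l < k" "i < m" for l i
    using that k by (simp add: G_def standard_gen_mat_def A_def d)
  have p_less: "p i < m" if "i < m" for i
    using that permutes_in_image[OF p, of i] by simp
  have row: "vec m (\<lambda>i. vec m (\<lambda>i. \<Sum>l<k. c l * d l $ i) $ p i) = transpose_mat G *\<^sub>v x"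
    if "x = vec k c" for c x
  proof (rule eq_vecI)
    fix i assume "i < dim_vec (transpose_mat G *\<^sub>v x)"
    then have i: "i < m" by (simp add: dims)
    then show "vec m (\<lambda>i. vec m (\<lambda>i. \<Sum>l<k. c l * d l $ i) $ p i) $ i = (transpose_mat G *\<^sub>v x) $ i"
      using that by (simp add: dims p_less scalar_prod_def G lessThan_atLeast0 mult.commute)
  qed (simp add: dims)
  have "(\<lambda>v. vec m (\<lambda>i. v $ p i)) ` D = (\<lambda>v. transpose_mat G *\<^sub>v v) ` carrier_vec k"
  proof (intro equalityI subsetI)
    fix v assume "v \<in> (\<lambda>v. vec m (\<lambda>i. v $ p i)) ` D"
    then obtain c where "v = vec m (\<lambda>i. vec m (\<lambda>i. \<Sum>l<k. c l * d l $ i) $ p i)"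
      unfolding D by blast
    then have "v = transpose_mat G *\<^sub>v vec k c"
      using row by simp
    then show "v \<in> (\<lambda>v. transpose_mat G *\<^sub>v v) ` carrier_vec k"
      by simp
  next
    fix v assume "v \<in> (\<lambda>v. transpose_mat G *\<^sub>v v) ` carrier_vec k"
    then obtain x where x: "x \<in> carrier_vec k" "v = transpose_mat G *\<^sub>v x" by blast
    then have "x = vec k (\<lambda>l. x $ l)" by auto
    from row[OF this] have "v = vec m (\<lambda>i. vec m (\<lambda>i. \<Sum>l<k. x $ l * d l $ i) $ p i)"
      by (simp add: x)
    then show "v \<in> (\<lambda>v. vec m (\<lambda>i. v $ p i)) ` D"
      unfolding D by blast
  qed
  moreover have "A \<in> carrier_mat k (m - k)"
    by (simp add: A_def)
  ultimately show ?thesis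
    using k p unfolding has_type_one_def G_def by blast
qed

text \<open>The cyclic shift, continued by the identity as \<open>permutes\<close> demands; it
  brings the coordinates from \<open>q\<close> on to the front.\<close>

lemma rotation_permutes:
  fixes m q :: nat
  assumes "0 < m"
  shows "(\<lambda>i. if i < m then (i + q) mod m else i) permutes {..<m}"
proof (rule bij_imp_permutes)
  have "inj_on (\<lambda>i. if i < m then (i + q) mod m else i) {..<m}"
  proof (rule inj_onI)
    fix x y assume "x \<in> {..<m}" "y \<in> {..<m}"
      and eq: "(if x < m then (x + q) mod m else x) = (if y < m then (y + q) mod m else y)"
    then have "x < m" "y < m" "[x + q = y + q] (mod m)"
      by (simp_all add: cong_def)
    then show "x = y"
      by (simp add: cong_add_rcancel_nat cong_less_modulus_unique_nat)
  qed
  moreover have "(\<lambda>i. if i < m then (i + q) mod m else i) ` {..<m} \<subseteq> {..<m}"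
    using assms by auto
  ultimately show "bij_betw (\<lambda>i. if i < m then (i + q) mod m else i) {..<m} {..<m}"
    unfolding bij_betw_def using endo_inj_surj[OF finite_lessThan] by blast
qed simp

section \<open>The extended code and its Fourier transform\<close>

context qr_root_of_unity
begin

text \<open>Discrete Fourier transform of the first \<open>n\<close> coordinates; the extension
  coordinate \<open>v $ n\<close> is left out, so it applies directly to vectors of length
  \<open>n + 1\<close>.\<close>

definition dft :: "z2adic vec \<Rightarrow> nat \<Rightarrow> q2adic alg_closure" where
  "dft v j = (\<Sum>k<n. z2_to_ac (v $ k) * (\<xi> ^ j) ^ k)"

lemma dft_mod: "dft v (j mod n) = dft v j"
  by (simp add: dft_def root_pow_mod)

lemma dft_minus: "dft v ((n - 1) * j) = (\<Sum>k<n. z2_to_ac (v $ k) * inverse (\<xi> ^ j) ^ k)"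
  by (simp add: dft_def inverse_root_pow)

lemma dft_0: "dft v 0 = z2_to_ac (\<Sum>k<n. v $ k)"
  by (simp add: dft_def z2_to_ac_simps)

text \<open>Fourier inversion, as Parseval's identity against a unit vector.\<close>

lemma dft_eqD:
  assumes "\<And>j. j < n \<Longrightarrow> dft v j = dft w j" and k: "k < n"
  shows "v $ k = w $ k"
proof -
  have "of_nat n * z2_to_ac (v $ k) = (\<Sum>j<n. dft v j * inverse (\<xi> ^ j) ^ k)" for v
    using parseval[of "\<lambda>a. z2_to_ac (v $ a)" "\<lambda>b. if b = k then 1 else 0"] k
    by (simp add: dft_def if_distrib[of "(*) _"] if_distrib[of "\<lambda>x. x * _"] cong: if_cong)
  then have "of_nat n * z2_to_ac (v $ k) = of_nat n * z2_to_ac (w $ k)"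
    using assms by simp
  then show ?thesis
    using n_pos by simp
qed

lemma dft_inner:
  "of_nat n * z2_to_ac (\<Sum>k<n. v $ k * w $ k) = (\<Sum>j<n. dft v j * dft w ((n - 1) * j))"
  unfolding dft_minus using parseval[of "\<lambda>a. z2_to_ac (v $ a)" "\<lambda>a. z2_to_ac (w $ a)"]
  by (simp add: dft_def z2_to_ac_simps)

text \<open>Transform description of D, with u(1) written as the coordinate sum. As \<open>j\<close>
  is not bounded by \<open>n\<close>, exponents such as \<open>(n - 1) * j\<close> need no
  reduction.\<close>

definition ext_code :: "z2adic \<Rightarrow> z2adic vec set" where
  "ext_code t = {v \<in> carrier_vec (n + 1). (\<forall>j. \<chi> j = 1 \<longrightarrow> dft v j = 0) \<and> v $ n = t * (\<Sum>k<n. v $ k)}"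

lemma dft_add: "v \<in> carrier_vec (n + 1) \<Longrightarrow> w \<in> carrier_vec (n + 1) \<Longrightarrow> dft (v + w) j = dft v j + dft w j"
  by (simp add: dft_def z2_to_ac_simps algebra_simps sum.distrib)

lemma dft_smult: "v \<in> carrier_vec (n + 1) \<Longrightarrow> dft (c \<cdot>\<^sub>v v) j = z2_to_ac c * dft v j"
  by (simp add: dft_def z2_to_ac_simps algebra_simps sum_distrib_left)

lemma dft_zero: "dft (0\<^sub>v (n + 1)) j = 0"
  by (simp add: dft_def)

lemma linear_ext_code: "linear_code (n + 1) (ext_code t)"
proof (rule linear_codeI)
  fix c and v w assume v: "v \<in> ext_code t" and w: "w \<in> ext_code t"
  have "(\<Sum>k<n. (v + w) $ k) = (\<Sum>k<n. v $ k + w $ k)" "(\<Sum>k<n. (c \<cdot>\<^sub>v v) $ k) = (\<Sum>k<n. c * v $ k)"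
    using v w by (auto simp: ext_code_def intro!: sum.cong)
  moreover have "(v + w) $ n = v $ n + w $ n" "(c \<cdot>\<^sub>v v) $ n = c * v $ n"
    using v w by (auto simp: ext_code_def)
  ultimately show "v + w \<in> ext_code t" "c \<cdot>\<^sub>v v \<in> ext_code t"
    using v w by (simp_all add: ext_code_def dft_add dft_smult sum.distrib distrib_left mult.left_commute
        flip: sum_distrib_left)
qed (auto simp: ext_code_def dft_zero[simplified])

definition ext_vec :: "z2adic \<Rightarrow> z2adic poly \<Rightarrow> z2adic vec" where
  "ext_vec t f = cyc_coeffs n (cyc_class n f) @\<^sub>v vec_of_list [t]"

lemma ext_vec_carrier: "ext_vec t f \<in> carrier_vec (n + 1)"
  and ext_vec_last: "ext_vec t f $ n = t"
  using cyc_coeffs_spec(1)[OF n_pos, of f] by (auto simp: ext_vec_def intro: carrier_vecI)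

lemma dft_ext_vec: "dft (ext_vec t f) j = ac_eval f (\<xi> ^ j)"
proof -
  define v where "v = cyc_coeffs n (cyc_class n f)"
  have v: "dim_vec v = n"
    using cyc_coeffs_spec(1)[OF n_pos, of f] by (simp add: v_def)
  obtain h where "Poly (list_of_vec v) - f = (monom 1 n - 1) * h"
    using cyc_coeffs_spec(2)[OF n_pos, of f] by (auto simp: v_def dvd_def)
  then have "ac_eval (Poly (list_of_vec v)) (\<xi> ^ j) - ac_eval f (\<xi> ^ j)
      = ((\<xi> ^ j) ^ n - 1) * ac_eval h (\<xi> ^ j)"
    by (metis (no_types, lifting) ac_eval_simps(2,6,9,11) mult_1_left z2_to_ac.hom_one)
  also have "(\<xi> ^ j) ^ n = 1"
    by (metis power_mult mult.commute root_pow_n power_one)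
  finally have "ac_eval f (\<xi> ^ j) = ac_eval (Poly (list_of_vec v)) (\<xi> ^ j)"
    by simp
  also have "\<dots> = dft (ext_vec t f) j"
    using v by (simp add: ac_eval_Poly dft_def ext_vec_def list_of_vec_index flip: v_def)
  finally show ?thesis ..
qed

definition ext_gen :: "z2adic \<Rightarrow> nat \<Rightarrow> z2adic vec" where
  "ext_gen t i = ext_vec t (monom 1 i * idem1)"

lemma dft_ext_gen: "dft (ext_gen t i) j = (if \<chi> j = 1 then 0 else (\<xi> ^ j) ^ i)"
  by (simp add: ext_gen_def dft_ext_vec ac_eval_simps ac_eval_idem1)

text \<open>\<open>idem1\<close> has the value 1 at 1, so each shift has coordinate sum 1 and the
  appended entry is \<open>t\<close> times that sum.\<close>

lemma ext_gen_in_ext_code: "ext_gen t i \<in> ext_code t"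
proof -
  have "z2_to_ac (\<Sum>k<n. ext_gen t i $ k) = 1"
    using dft_ext_gen[of t i 0] \<chi>_eq_0_iff[of 0] by (simp flip: dft_0)
  then have "(\<Sum>k<n. ext_gen t i $ k) = 1"
    by simp
  then show ?thesis
    by (simp add: ext_code_def dft_ext_gen) (simp add: ext_gen_def ext_vec_carrier[simplified] ext_vec_last)
qed

text \<open>The idempotent acts as the identity on its ideal, so the first \<open>n\<close>
  coordinates of a codeword serve as its own coefficients with respect to the shifts.\<close>

lemma code_span_ext_gen: "code_span (n + 1) (ext_gen t ` {..<n}) = ext_code t"
proof
  show "code_span (n + 1) (ext_gen t ` {..<n}) \<subseteq> ext_code t"
    by (intro code_span_subset linear_ext_code) (auto simp: ext_gen_in_ext_code)
  show "ext_code t \<subseteq> code_span (n + 1) (ext_gen t ` {..<n})"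
  proof
    fix v assume v: "v \<in> ext_code t"
    define w where "w = vec (n + 1) (\<lambda>k. \<Sum>i<n. v $ i * ext_gen t i $ k)"
    have sub: "ext_gen t ` {..<n} \<subseteq> carrier_vec (n + 1)"
      by (auto simp: ext_gen_def ext_vec_carrier[simplified])
    have "w \<in> code_span (n + 1) (ext_gen t ` {..<n})"
      unfolding w_def using linear_code_span[OF sub] by (intro linear_code_sum) auto
    moreover have "v = w"
    proof (rule eq_vecI)
      have "dft w j = dft v j" for j
      proof -
        have "dft w j = (\<Sum>i<n. z2_to_ac (v $ i) * dft (ext_gen t i) j)"
          unfolding dft_def by (simp add: w_def z2_to_ac_simps sum_distrib_left sum_distrib_right mult.assoc)
            (rule sum.swap)
        also have "\<dots> = (if \<chi> j = 1 then 0 else dft v j)"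
          by (simp add: dft_ext_gen) (simp add: dft_def)
        also have "\<dots> = dft v j"
          using v by (simp add: ext_code_def)
        finally show ?thesis .
      qed
      then have "v $ k = w $ k" if "k < n" for k
        using dft_eqD[of v w] that by simp
      moreover have "v $ n = w $ n"
        using v by (simp add: w_def ext_code_def ext_gen_def ext_vec_last sum_distrib_left mult.commute)
      moreover have "dim_vec w = n + 1"
        by (simp add: w_def)
      ultimately show "v $ k = w $ k" if "k < dim_vec w" for k
        using that by (metis less_Suc_eq Suc_eq_plus1)
      show "dim_vec v = dim_vec w"
        using v by (simp add: w_def ext_code_def)
    qed
    ultimately show "v \<in> code_span (n + 1) (ext_gen t ` {..<n})" by simp
  qed
qed

section \<open>Self-duality\<close>

lemma scalar_prod_Suc: "v \<in> carrier_vec (n + 1) \<Longrightarrow> w \<in> carrier_vec (n + 1) \<Longrightarrow>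
    v \<bullet> w = (\<Sum>k<n. v $ k * w $ k) + v $ n * w $ n"
  for v w :: "z2adic vec"
  by (simp add: scalar_prod_def lessThan_atLeast0)

lemma \<chi>_minus: "\<chi> ((n - 1) * j) = - \<chi> j"
  unfolding \<chi>_mult \<chi>_minus_one by simp

text \<open>For nonzero \<open>j < n\<close>, one of \<open>j\<close> and \<open>- j\<close> is a
  residue, so only frequency 0 survives in Parseval's identity. Hence \<open>n\<close> times the
  inner product of the first \<open>n\<close> coordinates is the product of the coordinate sums,
  which the last coordinates cancel because \<open>of_nat n * t ^ 2 = - 1\<close>.\<close>

lemma ext_code_orthogonal:
  assumes t: "of_nat n * t ^ 2 = - 1" and v: "v \<in> ext_code t" and w: "w \<in> ext_code t"
  shows "v \<bullet> w = 0"
proof -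
  have "dft v j * dft w ((n - 1) * j) = (if j = 0 then dft v 0 * dft w 0 else 0)" if "j < n" for j
    using v w \<chi>_cases[of j] \<chi>_eq_0_iff[of j] that \<chi>_minus[of j]
    by (auto simp: ext_code_def dest: dvd_imp_le)
  then have "of_nat n * z2_to_ac (\<Sum>k<n. v $ k * w $ k) = dft v 0 * dft w 0"
    using n_pos by (simp add: dft_inner)
  then have "z2_to_ac (of_nat n * (\<Sum>k<n. v $ k * w $ k)) = z2_to_ac ((\<Sum>k<n. v $ k) * (\<Sum>k<n. w $ k))"
    by (simp only: dft_0 z2_to_ac.hom_mult z2_to_ac.hom_of_nat)
  then have "of_nat n * (\<Sum>k<n. v $ k * w $ k) = (\<Sum>k<n. v $ k) * (\<Sum>k<n. w $ k)"
    by (simp only: z2_to_ac.eq_iff)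
  moreover have "of_nat n * (v $ n * w $ n) = (of_nat n * t ^ 2) * ((\<Sum>k<n. v $ k) * (\<Sum>k<n. w $ k))"
    using v w by (simp add: ext_code_def power2_eq_square ac_simps)
  ultimately have "of_nat n * (v \<bullet> w) = 0"
    using v w by (simp add: scalar_prod_Suc ext_code_def t distrib_left)
  then show ?thesis
    using n_pos by simp
qed

text \<open>Orthogonality to the shifts of \<^term>\<open>idem1\<close> says that the transform of \<open>w\<close>, cut off by that of
  \<^term>\<open>idem1\<close>, has constant inverse transform.\<close>

lemma dual_ext_code_subset:
  assumes t: "of_nat n * t ^ 2 = - 1" and w: "w \<in> carrier_vec (n + 1)"
    and orth: "\<And>i. i < n \<Longrightarrow> ext_gen t i \<bullet> w = 0"
  shows "w \<in> ext_code t"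
proof -
  define h where "h j = dft w j * (if \<chi> ((n - 1) * j) = 1 then 0 else 1)" for j
  define c where "c = - of_nat n * (t * w $ n)"
  have h: "(\<Sum>j<n. h j * inverse (\<xi> ^ j) ^ i) = z2_to_ac c" if i: "i < n" for i
  proof -
    have "ext_gen t i \<in> carrier_vec (n + 1)" "ext_gen t i $ n = t"
      by (simp_all add: ext_gen_def ext_vec_last ext_vec_carrier[simplified])
    then have "(\<Sum>k<n. w $ k * ext_gen t i $ k) = - (t * w $ n)"
      using orth[OF i] w by (simp add: scalar_prod_Suc eq_neg_iff_add_eq_0 mult.commute)
    then have "z2_to_ac c = of_nat n * z2_to_ac (\<Sum>k<n. w $ k * ext_gen t i $ k)"
      by (simp add: c_def z2_to_ac_simps)
    also have "\<dots> = (\<Sum>j<n. dft w j * dft (ext_gen t i) ((n - 1) * j))"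
      by (rule dft_inner)
    also have "\<dots> = (\<Sum>j<n. h j * inverse (\<xi> ^ j) ^ i)"
      unfolding dft_ext_gen by (intro sum.cong) (simp_all add: h_def inverse_root_pow)
    finally show ?thesis ..
  qed
  \<comment> \<open>Fourier inversion: a constant inverse transform comes from frequency 0
    alone.\<close>
  have h_eq: "h k = (if k = 0 then z2_to_ac c else 0)" if k: "k < n" for k
  proof -
    have "of_nat n * h k = (\<Sum>j<n. h j * (if k = j then of_nat n else 0))"
      using k by (simp add: if_distrib[of "(*) _"] cong: if_cong)
    also have "\<dots> = (\<Sum>j<n. h j * (\<Sum>i<n. (\<xi> ^ i) ^ k * inverse (\<xi> ^ i) ^ j))"
      using k by (intro sum.cong refl) (simp add: character_orthogonality)
    also have "\<dots> = (\<Sum>i<n. (\<xi> ^ k) ^ i * (\<Sum>j<n. h j * inverse (\<xi> ^ j) ^ i))"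
      unfolding sum_distrib_left by (subst sum.swap)
        (intro sum.cong refl, simp add: ac_simps power_inverse flip: power_mult)
    also have "\<dots> = z2_to_ac c * (\<Sum>i<n. (\<xi> ^ k) ^ i)"
      by (simp add: h sum_distrib_left mult.commute)
    also have "\<dots> = of_nat n * (if k = 0 then z2_to_ac c else 0)"
      using k by (auto simp: sum_root_pow dest: dvd_imp_le)
    finally show ?thesis
      using n_pos by simp
  qed
  have "dft w j = 0" if j: "\<chi> j = 1" for j
  proof -
    define k where "k = j mod n"
    have k: "k < n" "\<chi> k = 1" "k \<noteq> 0"
      using n_pos j \<chi>_eq_0_iff[of j] by (simp_all add: k_def \<chi>_mod dvd_eq_mod_eq_0)
    \<comment> \<open>For a residue \<open>k\<close> the index \<open>- k\<close> is a nonresidue,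
      so the cut-off keeps this frequency.\<close>
    then have "dft w k = h k"
      using \<chi>_minus[of k] by (simp add: h_def)
    then show ?thesis
      using h_eq k by (simp add: k_def dft_mod)
  qed
  \<comment> \<open>Frequency 0 determines the coordinate sum; multiplying by \<open>t\<close>
    recovers \<open>w $ n\<close>.\<close>
  moreover have "z2_to_ac (\<Sum>k<n. w $ k) = z2_to_ac c"
    using h_eq[of 0] \<chi>_eq_0_iff[of 0] n_pos by (simp add: h_def dft_0)
  then have "t * (\<Sum>k<n. w $ k) = - (of_nat n * t ^ 2) * w $ n"
    by (simp add: c_def power2_eq_square ac_simps)
  ultimately show ?thesis
    using w by (simp add: ext_code_def t)
qed

lemma self_dual_ext_code:
  assumes "of_nat n * t ^ 2 = - 1"
  shows "self_dual_code (n + 1) (ext_code t)"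
proof -
  have "ext_code t \<subseteq> dual_code (n + 1) (ext_code t)"
    using ext_code_orthogonal[OF assms] by (auto simp: dual_code_def) (simp add: ext_code_def)
  moreover have "dual_code (n + 1) (ext_code t) \<subseteq> ext_code t"
    using dual_ext_code_subset[OF assms] ext_gen_in_ext_code by (auto simp: dual_code_def)
  ultimately show ?thesis
    unfolding self_dual_code_def using linear_ext_code by blast
qed

section \<open>Systematic generators and the type\<close>

lemma ext_code_systematic:
  "\<exists>v\<in>ext_code t. \<forall>i\<le>card Q. v $ (card Q + i) = (if i = l then 1 else 0)"
proof (cases "l \<le> card Q")
  \<comment> \<open>For \<open>l\<close> beyond \<open>card Q\<close> the zero vector is a default,
    so that a vector can be chosen for every \<open>l\<close>.\<close>
  case False
  have "0\<^sub>v (n + 1) \<in> ext_code t"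
    by (rule linear_codeD(2)[OF linear_ext_code])
  then show ?thesis
    using False card_Q by (intro bexI[of _ "0\<^sub>v (n + 1)"]) auto
next
  case True
  \<comment> \<open>Subtracting the remainder leaves a multiple of \<open>residue_poly\<close> with
    the coefficients of \<open>monom 1 (card Q + l)\<close> in all degrees from
    \<open>card Q\<close> on; its degree stays below \<open>n = 2 * card Q + 1\<close> as
    \<open>l \<le> card Q\<close>.\<close>
  obtain h r where hr: "monom 1 (card Q + l) = residue_poly * h + r" and r: "r = 0 \<or> degree r < card Q"
    using monic_division[OF lead_coeff_residue_poly, of "monom 1 (card Q + l)"]
    by (auto simp: degree_residue_poly)
  define f where "f = monom 1 (card Q + l) - r"
  define v where "v = vec (n + 1) (\<lambda>i. if i < n then coeff f i else t * (\<Sum>k<n. coeff f k))"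
  have top: "coeff f (card Q + i) = (if i = l then 1 else 0)" for i
    using r by (auto simp: f_def coeff_eq_0)
  have "degree f < n"
  proof (rule degree_lessI)
    show "\<forall>k\<ge>n. coeff f k = 0"
    proof (intro allI impI)
      fix k assume "n \<le> k"
      then have "k = card Q + (k - card Q)" "k - card Q \<noteq> l"
        using card_Q True by auto
      then show "coeff f k = 0"
        using top by metis
    qed
  qed (use n_pos in simp)
  then have "ac_eval f x = (\<Sum>k<n. z2_to_ac (coeff f k) * x ^ k)" for x
    unfolding ac_eval_eq_sum by (intro sum.mono_neutral_left) (auto simp: coeff_eq_0)
  then have "dft v j = ac_eval f (\<xi> ^ j)" for j
    by (simp add: dft_def v_def)
  moreover have "ac_eval f (\<xi> ^ j) = 0" if "\<chi> j = 1" for j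
  proof -
    have "j mod n \<in> Q"
      using that n_pos by (simp add: mem_Q_iff \<chi>_mod)
    then have "ac_eval residue_poly (\<xi> ^ j) = 0"
      unfolding ac_eval_residue_poly_eq_0_iff by (metis root_pow_mod)
    moreover have "f = residue_poly * h"
      using hr by (simp add: f_def)
    ultimately show ?thesis
      by (simp add: ac_eval_simps)
  qed
  ultimately have "v \<in> ext_code t"
    by (simp add: ext_code_def v_def)
  moreover have "v $ (card Q + i) = (if i = l then 1 else 0)" if "i \<le> card Q" for i
    using that card_Q top by (simp add: v_def)
  ultimately show ?thesis by blast
qed

text \<open>The zero entries leave a polynomial of degree below \<open>card Q\<close>, which cannot
  have the \<open>card Q\<close> roots \<open>\<xi> ^ j\<close> unless it is zero. The last
  coordinate then follows from the coordinate sum.\<close>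

lemma ext_code_eq_0:
  assumes v: "v \<in> ext_code t" and 0: "\<And>i. i \<le> card Q \<Longrightarrow> v $ (card Q + i) = 0"
  shows "v = 0\<^sub>v (n + 1)"
proof -
  define f where "f = (\<Sum>i<n. monom (v $ i) i)"
  have coeff_f: "coeff f i = (if i < n then v $ i else 0)" for i
    by (simp add: f_def coeff_sum)
  have "f = 0"
  proof (rule ccontr)
    assume "f \<noteq> 0"
    have "ac_eval f (\<xi> ^ j) = dft v j" for j
      by (simp add: f_def dft_def ac_eval_sum ac_eval_simps)
    then have "card ((\<lambda>j. \<xi> ^ j) ` Q) \<le> degree f"
      using v \<open>f \<noteq> 0\<close> by (intro card_le_degree_if_roots) (auto simp: ext_code_def mem_Q_iff)
    then have "card Q \<le> degree f"
      by (simp add: card_image_root_pow Q_subset)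
    then obtain i where i: "degree f = card Q + i"
      using le_Suc_ex by blast
    have "lead_coeff f \<noteq> 0"
      using \<open>f \<noteq> 0\<close> by simp
    then have "card Q + i < n" "v $ (card Q + i) \<noteq> 0"
      by (auto simp: coeff_f i split: if_splits)
    then show False
      using 0[of i] card_Q by simp
  qed
  then have *: "v $ k = 0" if "k < n" for k
    using coeff_f[of k] that by simp
  then have "v $ n = 0"
    using v by (simp add: ext_code_def)
  then show ?thesis
    using v * by (intro eq_vecI) (auto simp: ext_code_def less_Suc_eq)
qed

lemma has_type_one_ext_code: "has_type_one (n + 1) ((n + 1) div 2) (ext_code t)"
proof -
  let ?q = "card Q"
  obtain d where d: "\<And>l. d l \<in> ext_code t"
      "\<And>l i. i \<le> ?q \<Longrightarrow> d l $ (?q + i) = (if i = l then 1 else 0)"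
    using ext_code_systematic by metis
  have half: "(n + 1) div 2 = ?q + 1"
    using card_Q by simp
  show ?thesis
    unfolding half
  proof (rule has_type_oneI)
    show "?q + 1 \<le> n + 1"
      using card_Q by simp
    \<comment> \<open>The information coordinates \<open>card Q, ..., 2 * card Q\<close>, the last
      being \<open>n - 1\<close>, move to the front.\<close>
    show "(\<lambda>i. if i < n + 1 then (i + ?q) mod (n + 1) else i) permutes {..<n + 1}"
      by (rule rotation_permutes) simp
    show "d l $ (if i < n + 1 then (i + ?q) mod (n + 1) else i) = (if i = l then 1 else 0)"
      if "i < ?q + 1" "l < ?q + 1" for i l
      using that d(2)[of i l] card_Q by (simp add: add.commute)
    show "ext_code t = range (\<lambda>c. vec (n + 1) (\<lambda>i. \<Sum>l<?q + 1. c l * d l $ i))"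
    proof (intro equalityI subsetI)
      fix v assume "v \<in> range (\<lambda>c. vec (n + 1) (\<lambda>i. \<Sum>l<?q + 1. c l * d l $ i))"
      then show "v \<in> ext_code t"
        using linear_code_sum[OF linear_ext_code, of "{..<?q + 1}" d] d(1) by blast
    next
      fix v assume v: "v \<in> ext_code t"
      \<comment> \<open>The combination agreeing with \<open>v\<close> on the information
        coordinates; the difference vanishes there, hence everywhere.\<close>
      define w where "w = vec (n + 1) (\<lambda>i. \<Sum>l<?q + 1. v $ (?q + l) * d l $ i)"
      have w: "w \<in> ext_code t"
        unfolding w_def using d(1) by (intro linear_code_sum linear_ext_code) auto
      have car: "v \<in> carrier_vec (n + 1)" "w \<in> carrier_vec (n + 1)"
        using v w by (simp_all add: ext_code_def)
      have "v + (- 1) \<cdot>\<^sub>v w \<in> ext_code t"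
        using linear_codeD(3,4)[OF linear_ext_code] v w by blast
      moreover have "(v + (- 1) \<cdot>\<^sub>v w) $ (?q + i) = 0" if "i \<le> ?q" for i
      proof -
        have "w $ (?q + i) = (\<Sum>l<?q + 1. v $ (?q + l) * (if i = l then 1 else 0))"
          using that card_Q by (simp add: w_def d(2))
        also have "\<dots> = v $ (?q + i)"
          using that by (simp add: if_distrib[of "(*) _"] less_Suc_eq_le del: sum.lessThan_Suc cong: if_cong)
        finally show ?thesis
          using that car card_Q by simp
      qed
      ultimately have "v + (- 1) \<cdot>\<^sub>v w = 0\<^sub>v (n + 1)"
        by (rule ext_code_eq_0)
      then have "v $ i - w $ i = 0" if "i < n + 1" for i
        using that car by (metis (no_types, lifting) index_add_vec(1) index_smult_vec(1) index_zero_vec(1)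
            carrier_vecD index_smult_vec(2) minus_one_mult_self mult_minus1 diff_conv_add_uminus)
      then have "v = w"
        using car by (intro eq_vecI) auto
      show "v \<in> range (\<lambda>c. vec (n + 1) (\<lambda>i. \<Sum>l<?q + 1. c l * d l $ i))"
      proof (rule range_eqI)
        show "v = vec (n + 1) (\<lambda>i. \<Sum>l<?q + 1. v $ (?q + l) * d l $ i)"
          using \<open>v = w\<close> unfolding w_def .
      qed
    qed
  qed
qed

section \<open>Coefficients as 2-adic fractions and the final statement\<close>

lemma to_fract_2: "to_fract 2 = (2 :: q2adic)"
  using of_nat_fract_conv[of 2, where 'a = z2adic] by simp

lemma to_fract_times_n_inv: "to_fract (c * n_inv) = to_fract (2 * c) / (2 * of_nat n)"
proof -
  have "of_nat n * to_fract n_inv = 1"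
    using arg_cong[OF n_inv, of to_fract] by (simp add: of_nat_fract_conv)
  moreover have "of_nat n \<noteq> (0 :: q2adic)"
    using n_pos by simp
  ultimately have "to_fract n_inv = 1 / of_nat n"
    by (simp add: eq_divide_eq mult.commute)
  then show ?thesis
    by (simp add: to_fract_2)
qed

lemma to_fract_square_iff: "to_fract t ^ 2 = - 1 / of_nat n \<longleftrightarrow> of_nat n * t ^ 2 = - 1"
  for t :: z2adic
proof -
  have nonzero: "of_nat n \<noteq> (0 :: q2adic)"
    using n_pos by simp
  have "to_fract t ^ 2 = - 1 / of_nat n \<longleftrightarrow> of_nat n * to_fract t ^ 2 = - 1"
    unfolding eq_divide_eq if_P[OF nonzero] by (simp only: mult.commute)
  also have "\<dots> \<longleftrightarrow> to_fract (of_nat n * t ^ 2) = to_fract (- 1)"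
    by (simp only: of_nat_fract_conv power2_eq_square to_fract_mult to_fract_uminus to_fract_1)
  finally show ?thesis
    by (simp only: to_fract_eq_iff)
qed

end

theorem theorem7:
  fixes n :: nat and \<xi> :: "q2adic alg_closure"
    and Q N :: "nat set" and fQ fN :: "z2adic poly"
  assumes n: "Factorial_Ring.prime n" "n mod 8 = 7"
    and Q: "Q = quad_residues n" and N: "N = quad_nonresidues n"
    and fQ: "fQ = (\<Sum>i\<in>Q. monom 1 i)" and fN: "fN = (\<Sum>i\<in>N. monom 1 i)"
    and \<xi>: "primitive_root_of_unity n \<xi>"
  shows "\<exists>(\<pi> :: z2adic poly) (s :: z2adic) \<alpha>1 \<beta>1 \<gamma>1 \<alpha>2 \<beta>2 \<gamma>2 e1 e2.
     map_poly z2_to_ac \<pi> = (\<Prod>j\<in>Q. [:- (\<xi> ^ j), 1:]) \<and>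
     lead_coeff \<pi> = 1 \<and> \<pi> dvd monom 1 n - 1 \<and>
     (ord n 2 = (n - 1) div 2 \<longrightarrow> Factorial_Ring.irreducible \<pi>) \<and>
     z2_to_ac s = 1 + 2 * (\<Sum>j\<in>Q. \<xi> ^ j) \<and> s ^ 2 = - of_nat n \<and>
     to_fract \<alpha>1 = (of_nat n + 1) / (2 * of_nat n) \<and>
     to_fract \<beta>1 = (1 + to_fract s) / (2 * of_nat n) \<and>
     to_fract \<gamma>1 = (1 - to_fract s) / (2 * of_nat n) \<and>
     to_fract \<alpha>2 = (of_nat n - 1) / (2 * of_nat n) \<and>
     to_fract \<beta>2 = (- 1 + to_fract s) / (2 * of_nat n) \<and>
     to_fract \<gamma>2 = (- 1 - to_fract s) / (2 * of_nat n) \<and>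
     e1 = [:\<alpha>1:] + smult \<beta>1 fQ + smult \<gamma>1 fN \<and>
     e2 = [:\<alpha>2:] + smult \<beta>2 fQ + smult \<gamma>2 fN \<and>
     generated_by_idempotent (cyc_ring n)
       (PIdl\<^bsub>cyc_ring n\<^esub> (cyc_class n \<pi>)) (cyc_class n e1) \<and>
     generated_by_idempotent (cyc_ring n)
       (PIdl\<^bsub>cyc_ring n\<^esub> (cyc_class n ([:- 1, 1:] * \<pi>))) (cyc_class n e2) \<and>
     (\<forall>(t :: z2adic) D.
        to_fract t ^ 2 = - 1 / of_nat n \<and>
        D = code_span (n + 1)
              ((\<lambda>i. cyc_coeffs n (cyc_class n (monom 1 i * e1)) @\<^sub>v vec_of_list [t]) ` {..<n})
        \<longrightarrow> self_dual_code (n + 1) D \<and> has_type_one (n + 1) ((n + 1) div 2) D)"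
proof -
  interpret qr_root_of_unity n \<xi>
    using n \<xi> by unfold_locales
  let ?q = "of_nat (card (quad_residues n)) :: z2adic"
  \<comment> \<open>Each numerator in the stated fractions is twice a 2-adic integer, the shape that
    \<open>to_fract_times_n_inv\<close> produces over the denominator 2n.\<close>
  have n_conv: "of_nat n + 1 = to_fract (2 * (?q + 1))" "of_nat n - 1 = to_fract (2 * ?q)"
    by (simp_all add: of_nat_fract_conv of_nat_n flip: to_fract_1 to_fract_add to_fract_diff)
  have s_conv: "1 + to_fract (1 + 2 * period) = to_fract (2 * (1 + period))"
    "1 - to_fract (1 + 2 * period) = to_fract (2 * - period)"
    "- 1 + to_fract (1 + 2 * period) = to_fract (2 * period)"
    "- 1 - to_fract (1 + 2 * period) = to_fract (2 * (- 1 - period))"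
    by (simp_all add: to_fract_2 distrib_left right_diff_distrib)
  have gens: "(\<lambda>i. cyc_coeffs n (cyc_class n (monom 1 i * idem1)) @\<^sub>v vec_of_list [t]) = ext_gen t" for t
    by (simp add: fun_eq_iff ext_gen_def ext_vec_def)
  show ?thesis
  proof (rule exI[of _ residue_poly], rule exI[of _ "1 + 2 * period"],
      rule exI[of _ "(?q + 1) * n_inv"], rule exI[of _ "(1 + period) * n_inv"], rule exI[of _ "- period * n_inv"],
      rule exI[of _ "?q * n_inv"], rule exI[of _ "period * n_inv"], rule exI[of _ "(- 1 - period) * n_inv"],
      rule exI[of _ idem1], rule exI[of _ idem2], intro conjI allI impI)
    show "map_poly z2_to_ac residue_poly = (\<Prod>j\<in>Q. [:- (\<xi> ^ j), 1:])"
      unfolding assms by (rule map_residue_poly)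
    show "z2_to_ac (1 + 2 * period) = 1 + 2 * (\<Sum>j\<in>Q. \<xi> ^ j)"
      by (simp add: assms z2_to_ac_simps z2_to_ac_period)
    show "to_fract ((?q + 1) * n_inv) = (of_nat n + 1) / (2 * of_nat n)"
      "to_fract (?q * n_inv) = (of_nat n - 1) / (2 * of_nat n)"
      unfolding to_fract_times_n_inv n_conv by (rule refl)+
    show "to_fract ((1 + period) * n_inv) = (1 + to_fract (1 + 2 * period)) / (2 * of_nat n)"
      "to_fract (- period * n_inv) = (1 - to_fract (1 + 2 * period)) / (2 * of_nat n)"
      "to_fract (period * n_inv) = (- 1 + to_fract (1 + 2 * period)) / (2 * of_nat n)"
      "to_fract ((- 1 - period) * n_inv) = (- 1 - to_fract (1 + 2 * period)) / (2 * of_nat n)"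
      unfolding to_fract_times_n_inv s_conv by (rule refl)+
    show "idem1 = [:(?q + 1) * n_inv:] + smult ((1 + period) * n_inv) fQ + smult (- period * n_inv) fN"
      "idem2 = [:?q * n_inv:] + smult (period * n_inv) fQ + smult ((- 1 - period) * n_inv) fN"
      unfolding assms(3-6) idem1_def idem2_def char_comb_def by (rule refl)+
    fix t :: z2adic and D
    assume tD: "to_fract t ^ 2 = - 1 / of_nat n \<and> D = code_span (n + 1)
      ((\<lambda>i. cyc_coeffs n (cyc_class n (monom 1 i * idem1)) @\<^sub>v vec_of_list [t]) ` {..<n})"
    then have D: "D = ext_code t" and t: "of_nat n * t ^ 2 = - 1"
      by (simp_all only: gens code_span_ext_gen to_fract_square_iff)
    show "self_dual_code (n + 1) D" "has_type_one (n + 1) ((n + 1) div 2) D"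
      unfolding D using self_dual_ext_code[OF t] has_type_one_ext_code by blast+
  qed (use lead_coeff_residue_poly residue_poly_dvd_cyclic irreducible_residue_poly period_square
      idem1_generates idem2_generates in blast)+
qed

end
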